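(* Let $\lambda,\nu,\mu\in\mathbb{R}$, and let $\mathcal{D}_{\lambda,\nu;\mu}$ be the $\mathrm{sl}(2,\mathbb{R})$-module of bilinear differential operators $\mathcal{F}_\lambda\otimes\mathcal{F}_\nu\to\mathcal{F}_\mu$. The first (differentiable) cohomology group of $\mathrm{sl}(2,\mathbb{R})$ with coefficients in $\mathcal{D}_{\lambda,\nu;\mu}$ is, as a real vector space, the following. (i) If $\mu=\lambda+\nu$, then $\mathrm{H}^1(\mathrm{sl}(2,\mathbb{R});\mathcal{D}_{\lambda,\nu;\mu})\simeq\mathbb{R}$. (ii) If $\mu-\lambda-\nu=k$, where $k$ is a positive integer, then $$\mathrm{H}^1(\mathrm{sl}(2,\mathbb{R});\mathcal{D}_{\lambda,\nu;\mu})\simeq\begin{cases}\mathbb{R}^3,&\text{if }(\lambda,\nu)=\left(-\tfrac{s}{2},-\tfrac{t}{2}\right)\text{ for some integers } s,t \text{ with } 0\le s,t\le k-1 \text{ and } t>k-s-2,\\ \mathbb{R},&\text{otherwise.}\end{cases}$$ (iii) If $\mu-\lambda-\nu$ is not a non-negative integer, then $\mathrm{H}^1(\mathrm{sl}(2,\mathbb{R});\mathcal{D}_{\lambda,\nu;\mu})=0$.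
   Context: $\mathrm{Vect}(\mathbb{RP}^1)$ is the Lie algebra of smooth vector fields on $\mathbb{RP}^1$; in an affine coordinate $x$ a vector field is written $X\frac{d}{dx}$ and identified with its coefficient $X$, and $'$ denotes $d/dx$. $\mathrm{sl}(2,\mathbb{R})$ denotes the subalgebra of $\mathrm{Vect}(\mathbb{RP}^1)$ spanned by $\frac{d}{dx},\ x\frac{d}{dx},\ x^2\frac{d}{dx}$, which comes from the action of $\mathrm{SL}(2,\mathbb{R})$ on $\mathbb{RP}^1$ by $x\mapsto\frac{ax+b}{cx+d}$. For $\lambda\in\mathbb{R}$, $\mathcal{F}_\lambda$ is the space of tensor densities of weight $\lambda$ on $\mathbb{RP}^1$, i.e. the smooth sections of $(T^*\mathbb{RP}^1)^{\otimes\lambda}$, with $\mathrm{Vect}(\mathbb{RP}^1)$ acting by the Lie derivative $L_X^\lambda(\phi)=X\phi'+\lambda X'\phi$. $\mathcal{D}_{\lambda,\nu;\mu}$ is the space of bilinear differential operators $A:\mathcal{F}_\lambda\otimes\mathcal{F}_\nu\to\mathcal{F}_\mu$, with the action $$L_X^{\lambda,\nu;\mu}(A)(\phi,\psi)=L_X^\mu\big(A(\phi,\psi)\big)-A(L_X^\lambda\phi,\psi)-A(\phi,L_X^\nu\psi).$$ It is a $\mathrm{Vect}(\mathbb{RP}^1)$-module, and by restriction an $\mathrm{sl}(2,\mathbb{R})$-module. The cohomology considered is the "differentiable" one: only cochains given by differentiable maps are considered (i.e. $(X,\phi,\psi)\mapsto c(X,\phi,\psi)$ is a differential operator). A 1-cocycle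 is such a linear map $c:\mathrm{sl}(2,\mathbb{R})\to\mathcal{D}_{\lambda,\nu;\mu}$ with $c([X,Y])=L_X^{\lambda,\nu;\mu}c(Y)-L_Y^{\lambda,\nu;\mu}c(X)$. A 1-coboundary is a map $X\mapsto L_X^{\lambda,\nu;\mu}B$ with $B\in\mathcal{D}_{\lambda,\nu;\mu}$. $\mathrm{H}^1$ is the quotient of 1-cocycles by 1-coboundaries.
   Formalization: Densities and operator coefficients are smooth functions on the affine line R, not on all of RP^1 (no condition at infinity). Over RP^1 part (i) fails: for all weights 0, X ↦ X_θ and X ↦ X_θ' (times φψ, θ the angular coordinate) are independent classes. *)

theory Defs
  imports "HOL-Analysis.Analysis" "HOL-Library.Function_Algebras" "HOL-Library.Set_Algebras"
begin

section \<open>Smooth functions of the affine coordinate\<close>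

fun times_differentiable :: "nat \<Rightarrow> (real \<Rightarrow> real) \<Rightarrow> bool" where
  "times_differentiable 0 f \<longleftrightarrow> (\<forall>x. f differentiable (at x))"
| "times_differentiable (Suc n) f \<longleftrightarrow> (\<forall>x. f differentiable (at x)) \<and> times_differentiable n (deriv f)"

definition smooth :: "(real \<Rightarrow> real) \<Rightarrow> bool" where
  "smooth f \<longleftrightarrow> (\<forall>n x. (deriv ^^ n) f differentiable (at x))"

lemma times_differentiable_iff:
  "times_differentiable n f \<longleftrightarrow> (\<forall>m\<le>n. \<forall>x. (deriv ^^ m) f differentiable (at x))"
proof (induction n arbitrary: f)
  case (Suc n)
  have "(\<forall>m\<le>Suc n. P m) \<longleftrightarrow> P 0 \<and> (\<forall>m\<le>n. P (Suc m))" for P :: "nat \<Rightarrow> bool"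
    by (metis Suc_le_mono le0 not0_implies_Suc)
  from this[of "\<lambda>m. \<forall>x. (deriv ^^ m) f differentiable (at x)"] Suc show ?case
    by (simp add: funpow_Suc_right del: funpow.simps(2))
qed auto

lemma smooth_iff: "smooth f \<longleftrightarrow> (\<forall>n. times_differentiable n f)"
  unfolding smooth_def times_differentiable_iff by blast

lemma times_differentiable_0: "times_differentiable n f \<Longrightarrow> f differentiable (at x)"
  by (cases n) auto

lemma times_differentiable_SucD: "times_differentiable (Suc n) f \<Longrightarrow> times_differentiable n f"
  unfolding times_differentiable_iff by simp

lemma has_deriv: "(f::real \<Rightarrow> real) differentiable (at x) \<Longrightarrow> (f has_field_derivative deriv f x) (at x)"
  by (metis DERIV_imp_deriv real_differentiable_def)

lemma times_differentiable_const: "times_differentiable n (\<lambda>x. c)"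
  by (induction n arbitrary: c) auto

lemma times_differentiable_id: "times_differentiable n (\<lambda>x. x)"
  by (cases n) (auto simp: times_differentiable_const)

lemma times_differentiable_add:
  "times_differentiable n f \<Longrightarrow> times_differentiable n g \<Longrightarrow> times_differentiable n (\<lambda>x. f x + g x)"
proof (induction n arbitrary: f g)
  case (Suc n)
  have "deriv (\<lambda>x. f x + g x) = (\<lambda>x. deriv f x + deriv g x)"
    using Suc.prems by (auto intro!: ext DERIV_imp_deriv derivative_eq_intros has_deriv)
  with Suc show ?case by auto
qed auto

lemma times_differentiable_mult:
  "times_differentiable n f \<Longrightarrow> times_differentiable n g \<Longrightarrow> times_differentiable n (\<lambda>x. f x * g x)"
proof (induction n arbitrary: f g)
  case (Suc n)
  have eq: "deriv (\<lambda>x. f x * g x) = (\<lambda>x. deriv f x * g x + f x * deriv g x)"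
    using Suc.prems by (auto intro!: ext DERIV_imp_deriv derivative_eq_intros has_deriv)
  have "times_differentiable n f" "times_differentiable n g"
    using Suc.prems times_differentiable_SucD by blast+
  with Suc have "times_differentiable n (deriv (\<lambda>x. f x * g x))"
    unfolding eq by (intro times_differentiable_add Suc.IH) auto
  with Suc.prems show ?case by auto
qed auto

lemma times_differentiable_cmult: "times_differentiable n f \<Longrightarrow> times_differentiable n (\<lambda>x. c * f x)"
  by (intro times_differentiable_mult times_differentiable_const)

typedef smooth_fun = "{f. smooth f}"
  by (rule exI[of _ "\<lambda>x. 0"]) (auto simp: smooth_iff times_differentiable_const)

setup_lifting type_definition_smooth_fun

instantiation smooth_fun :: "{comm_ring_1, real_algebra_1}"
begin

lift_definition zero_smooth_fun :: smooth_fun is "\<lambda>x. 0"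
  by (simp add: smooth_iff times_differentiable_const)
lift_definition one_smooth_fun :: smooth_fun is "\<lambda>x. 1"
  by (simp add: smooth_iff times_differentiable_const)
lift_definition plus_smooth_fun :: "smooth_fun \<Rightarrow> smooth_fun \<Rightarrow> smooth_fun" is "\<lambda>f g x. f x + g x"
  by (simp add: smooth_iff times_differentiable_add)
lift_definition times_smooth_fun :: "smooth_fun \<Rightarrow> smooth_fun \<Rightarrow> smooth_fun" is "\<lambda>f g x. f x * g x"
  by (simp add: smooth_iff times_differentiable_mult)
lift_definition scaleR_smooth_fun :: "real \<Rightarrow> smooth_fun \<Rightarrow> smooth_fun" is "\<lambda>r f x. r * f x"
  by (simp add: smooth_iff times_differentiable_cmult)
lift_definition uminus_smooth_fun :: "smooth_fun \<Rightarrow> smooth_fun" is "\<lambda>f x. - f x"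
  using times_differentiable_cmult[of _ _ "-1"] by (simp add: smooth_iff)
lift_definition minus_smooth_fun :: "smooth_fun \<Rightarrow> smooth_fun \<Rightarrow> smooth_fun" is "\<lambda>f g x. f x - g x"
  using times_differentiable_add times_differentiable_cmult[of _ _ "-1"]
  by (fastforce simp: smooth_iff)

instance
  by standard (transfer, auto simp: fun_eq_iff algebra_simps)+

end

lift_definition coord :: smooth_fun is "\<lambda>x. x"
  by (simp add: smooth_iff times_differentiable_id)

lift_definition dx :: "smooth_fun \<Rightarrow> smooth_fun" is deriv
  unfolding smooth_iff using times_differentiable.simps(2) by blast


section \<open>The modules of densities and of bilinear differential operators\<close>

text \<open>
  Everything is written in the affine coordinate \<open>x\<close>: a vector field \<open>X d/dx\<close> and a
  density \<open>\<phi> (dx)\<^sup>\<lambda>\<close> are both represented by their coefficient, an element of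
  \<^typ>\<open>smooth_fun\<close>. The weight enters only through the action, so the spaces of densities of all
  weights have the same carrier. The coefficients are arbitrary smooth functions on the affine
  chart; no regularity at infinity is imposed. This matters: the cocycle
  \<open>X d/dx \<mapsto> ((\<phi>, \<psi>) \<mapsto> (X / (1 + x\<^sup>2)) \<phi> \<psi>)\<close> (all weights zero) is the coboundary of
  multiplication by \<open>arctan x\<close>, but over the whole projective line, where it is multiplication
  by the coefficient of \<open>X\<close> in the angular coordinate, it is not a coboundary.
\<close>

definition bracket :: "smooth_fun \<Rightarrow> smooth_fun \<Rightarrow> smooth_fun" where
  "bracket X Y = X * dx Y - dx X * Y"

definition sl2 :: "smooth_fun set" where
  "sl2 = span {1, coord, coord ^ 2}"

definition lie_density :: "real \<Rightarrow> smooth_fun \<Rightarrow> smooth_fun \<Rightarrow> smooth_fun" where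
  "lie_density l X \<phi> = X * dx \<phi> + l *\<^sub>R (dx X * \<phi>)"

type_synonym bilin = "smooth_fun \<Rightarrow> smooth_fun \<Rightarrow> smooth_fun"

definition bidiffops :: "bilin set" where
  "bidiffops = {A. \<exists>n a. \<forall>\<phi> \<psi>.
     A \<phi> \<psi> = (\<Sum>i\<le>n. \<Sum>j\<le>n. a i j * (dx ^^ i) \<phi> * (dx ^^ j) \<psi>)}"

definition lie_bidiffop :: "real \<Rightarrow> real \<Rightarrow> real \<Rightarrow> smooth_fun \<Rightarrow> bilin \<Rightarrow> bilin" where
  "lie_bidiffop l n m X A = (\<lambda>\<phi> \<psi>.
     lie_density m X (A \<phi> \<psi>) - A (lie_density l X \<phi>) \<psi> - A \<phi> (lie_density n X \<psi>))"


section \<open>First differentiable cohomology of sl(2)\<close>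

instantiation "fun" :: (type, real_vector) real_vector
begin

definition scaleR_fun :: "real \<Rightarrow> ('a \<Rightarrow> 'b) \<Rightarrow> 'a \<Rightarrow> 'b" where
  "scaleR_fun r f = (\<lambda>x. r *\<^sub>R f x)"

instance
  by standard (auto simp: scaleR_fun_def fun_eq_iff scaleR_add_right scaleR_add_left)

end

text \<open>
  A cochain is defined on \<^const>\<open>sl2\<close> only; as a HOL function it is extended by zero, so that
  cochains are equal iff they agree on \<^const>\<open>sl2\<close>.
\<close>

definition cochains :: "(smooth_fun \<Rightarrow> bilin) set" where
  "cochains = {c.
     (\<forall>X\<in>sl2. c X \<in> bidiffops) \<and>
     (\<forall>X\<in>sl2. \<forall>Y\<in>sl2. c (X + Y) = c X + c Y) \<and>
     (\<forall>r. \<forall>X\<in>sl2. c (r *\<^sub>R X) = r *\<^sub>R c X) \<and>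
     (\<exists>n a. \<forall>X\<in>sl2. \<forall>\<phi> \<psi>. c X \<phi> \<psi> =
        (\<Sum>r\<le>n. \<Sum>i\<le>n. \<Sum>j\<le>n. a r i j * (dx ^^ r) X * (dx ^^ i) \<phi> * (dx ^^ j) \<psi>)) \<and>
     (\<forall>X. X \<notin> sl2 \<longrightarrow> c X = 0)}"

definition cocycles :: "real \<Rightarrow> real \<Rightarrow> real \<Rightarrow> (smooth_fun \<Rightarrow> bilin) set" where
  "cocycles l n m = {c \<in> cochains. \<forall>X\<in>sl2. \<forall>Y\<in>sl2.
     c (bracket X Y) = lie_bidiffop l n m X (c Y) - lie_bidiffop l n m Y (c X)}"

definition coboundaries :: "real \<Rightarrow> real \<Rightarrow> real \<Rightarrow> (smooth_fun \<Rightarrow> bilin) set" where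
  "coboundaries l n m =
     {(\<lambda>X. if X \<in> sl2 then lie_bidiffop l n m X B else 0) | B. B \<in> bidiffops}"

text \<open>
  The quotient of \<open>V\<close> by a subspace \<open>U\<close> consists of the cosets \<open>v + U\<close>. Addition of cosets is the
  addition of sets. A scalar multiple is \<open>r P + U\<close>, the summand \<open>U\<close> being needed only when \<open>r = 0\<close>.
\<close>

definition quotient_space :: "'a::real_vector set \<Rightarrow> 'a set \<Rightarrow> 'a set set" where
  "quotient_space V U = {v +o U | v. v \<in> V}"

definition coset_scaleR :: "'a::real_vector set \<Rightarrow> real \<Rightarrow> 'a set \<Rightarrow> 'a set" where
  "coset_scaleR U r P = (\<lambda>v. r *\<^sub>R v) ` P + U"

definition quotient_isomorphic ::
    "'a::real_vector set \<Rightarrow> 'a set \<Rightarrow> 'b::real_vector set \<Rightarrow> bool" where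
  "quotient_isomorphic V U W \<longleftrightarrow> (\<exists>f.
     bij_betw f (quotient_space V U) W \<and>
     (\<forall>P\<in>quotient_space V U. \<forall>Q\<in>quotient_space V U. f (P + Q) = f P + f Q) \<and>
     (\<forall>r. \<forall>P\<in>quotient_space V U. f (coset_scaleR U r P) = r *\<^sub>R f P))"

definition H1_isomorphic :: "real \<Rightarrow> real \<Rightarrow> real \<Rightarrow> 'b::real_vector set \<Rightarrow> bool" where
  "H1_isomorphic l n m W \<longleftrightarrow> quotient_isomorphic (cocycles l n m) (coboundaries l n m) W"

end

theory Submission
  imports Defs
begin

text \<open>
  Since smooth functions on the affine line have antiderivatives, every cocycle is cohomologous to
  one vanishing on \<open>d/dx\<close>; such a cocycle has the form
  \<open>c(X) = X' C + X'' E / 2\<close> with \<open>C\<close>, \<open>E\<close> of constant coefficients. The Euler field \<open>x d/dx\<close>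
  acts on constant operators of order \<open>d\<close> by \<open>k - d\<close>, where \<open>k = \<mu> - \<lambda> - \<nu>\<close>, so only
  \<open>C\<close> of order \<open>k\<close> and \<open>E\<close> of order \<open>k - 1\<close> matter. Let \<open>T\<close> be minus the action of
  \<open>x\<^sup>2 d/dx\<close> at \<open>x = 0\<close>, from constant operators of order \<open>k\<close> to those of order \<open>k - 1\<close>. The
  cocycle condition says \<open>T C = 0\<close>, while \<open>E\<close> is determined modulo the image of \<open>T\<close>. Hence
  \<open>H\<^sup>1\<close> is \<open>ker T\<close> plus \<open>coker T\<close>, and \<open>T\<close> is a bidiagonal \<open>k \<times> (k + 1)\<close> matrix whose rank
  drops exactly when zeros on its two diagonals occur in the unfavourable order.
\<close>

subsection \<open>Calculus of smooth functions\<close>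

lemma smooth_DERIV: "smooth f \<Longrightarrow> (f has_field_derivative deriv f x) (at x)"
  unfolding smooth_def using has_deriv funpow_0 by metis

lemma smooth_fun_eqI: "(\<And>x. Rep_smooth_fun f x = Rep_smooth_fun g x) \<Longrightarrow> f = g"
  by (simp add: Rep_smooth_fun_inject[symmetric] fun_eq_iff)

lemma Rep_smooth_fun_numeral: "Rep_smooth_fun (numeral n) x = numeral n"
proof -
  have "numeral n = numeral n *\<^sub>R (1 :: smooth_fun)"
    by (simp add: scaleR_conv_of_real)
  then show ?thesis
    by (metis scaleR_smooth_fun.rep_eq one_smooth_fun.rep_eq mult.right_neutral)
qed

lemmas smooth_fun_eval = Rep_smooth_fun_numeral plus_smooth_fun.rep_eq minus_smooth_fun.rep_eq uminus_smooth_fun.rep_eq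
  times_smooth_fun.rep_eq scaleR_smooth_fun.rep_eq zero_smooth_fun.rep_eq one_smooth_fun.rep_eq
  coord.rep_eq

lemma scaleR_fun_apply: "(r *\<^sub>R f) x = r *\<^sub>R f x"
  by (simp add: scaleR_fun_def)

lemma linear_dx: "linear dx"
  by (rule linearI; transfer)
     (auto intro!: ext DERIV_imp_deriv derivative_eq_intros smooth_DERIV)

lemma linear_dx_funpow: "linear (dx ^^ n)"
proof (induction n)
  case 0
  then show ?case by (simp add: linear_id[unfolded id_def] id_def)
next
  case (Suc n)
  then show ?case using linear_compose[OF _ linear_dx] by (simp add: comp_def)
qed

lemma dx_mult: "dx (f * g) = dx f * g + f * dx g"
  by transfer (auto intro!: ext DERIV_imp_deriv derivative_eq_intros smooth_DERIV)

lemma dx_coord [simp]: "dx coord = 1"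
  by transfer (auto intro!: ext DERIV_imp_deriv derivative_eq_intros)

lemma dx_1 [simp]: "dx 1 = 0"
  by transfer (auto intro!: ext DERIV_imp_deriv derivative_eq_intros)

lemmas dx_linear = linear_add[OF linear_dx] linear_diff[OF linear_dx] linear_neg[OF linear_dx]
  linear_scale[OF linear_dx] linear_0[OF linear_dx]

lemma dx_power: "dx (f ^ n) = real n *\<^sub>R (f ^ (n - 1) * dx f)"
proof (induction n)
  case (Suc n)
  then show ?case
    by (cases n) (auto intro!: smooth_fun_eqI simp: dx_mult smooth_fun_eval algebra_simps)
qed simp

text \<open>Writing the constant as the value at 0 gives the criterion used later: a coefficient
  with zero derivative and zero value at 0 vanishes.\<close>

lemma dx_eq_0_iff: "dx f = 0 \<longleftrightarrow> f = Rep_smooth_fun f 0 *\<^sub>R 1"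
proof
  show "f = Rep_smooth_fun f 0 *\<^sub>R 1" if "dx f = 0"
    using that
  proof transfer
    fix f assume "smooth f" "deriv f = (\<lambda>x. 0)"
    then have "\<forall>x. (f has_field_derivative 0) (at x)"
      using smooth_DERIV[of f] by simp
    then show "f = (\<lambda>x. f 0 * 1)"
      using DERIV_isconst_all[of f] by fastforce
  qed
  show "dx f = 0" if "f = Rep_smooth_fun f 0 *\<^sub>R 1"
    by (subst that) (simp add: dx_linear)
qed

text \<open>Integration over the affine line. Normalising \<open>F\<close> at 0 makes the
  antiderivative of 0 equal to 0, so integrating coefficientwise preserves finiteness of the
  family.\<close>

lemma antiderivative_exists: "\<exists>F. dx F = f \<and> Rep_smooth_fun F 0 = 0"
proof transfer
  fix f assume f: "smooth f"
  have "\<exists>F. \<forall>x. -\<infinity> < ereal x \<longrightarrow> ereal x < \<infinity> \<longrightarrow> (F has_vector_derivative f x) (at x)"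
    using DERIV_isCont[OF smooth_DERIV[OF f]] by (intro einterval_antiderivative) auto
  then obtain F where F: "\<And>x. (F has_field_derivative f x) (at x)"
    by (auto simp: has_real_derivative_iff_has_vector_derivative)
  define G where "G x = F x - F 0" for x
  have G: "(G has_field_derivative f x) (at x)" for x
    unfolding G_def by (auto intro!: derivative_eq_intros F)
  then have dG: "deriv G = f"
    by (auto intro!: ext DERIV_imp_deriv)
  have "(deriv ^^ n) G differentiable (at x)" for n x
  proof (cases n)
    case 0
    then show ?thesis using G real_differentiable_def by auto
  next
    case (Suc m)
    then show ?thesis using f dG by (simp add: funpow_Suc_right smooth_def del: funpow.simps(2))
  qed
  then show "\<exists>F\<in>Collect smooth. deriv F = f \<and> F 0 = 0"
    using dG by (intro bexI[of _ G]) (auto simp: smooth_def G_def)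
qed

text \<open>Up to factorials, the powers of x - y are dual to the derivatives at
  \<open>y\<close>.\<close>

lemma Rep_dx_funpow_shifted_power:
  assumes "dx u = 1" "Rep_smooth_fun u y = 0"
  shows "Rep_smooth_fun ((dx ^^ i) (u ^ p)) y = (if i = p then fact p else 0)"
proof (induction i arbitrary: p)
  case 0
  have "Rep_smooth_fun (u ^ p) y = 0 ^ p"
    using assms(2) by (induction p) (auto simp: smooth_fun_eval)
  then show ?case by auto
next
  case (Suc i)
  have "(dx ^^ Suc i) (u ^ p) = real p *\<^sub>R (dx ^^ i) (u ^ (p - 1))"
    using assms(1)
    by (simp add: funpow_Suc_right dx_power linear_scale[OF linear_dx_funpow] del: funpow.simps(2))
  then show ?case
    using Suc by (cases p) (auto simp: smooth_fun_eval)
qed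

lemma Rep_coord_square: "Rep_smooth_fun (coord ^ 2) x = x * x"
  by (simp add: power2_eq_square smooth_fun_eval)

subsection \<open>The algebra sl(2)\<close>

lemma sl2_iff: "X \<in> sl2 \<longleftrightarrow> (\<exists>a b c. X = a *\<^sub>R 1 + b *\<^sub>R coord + c *\<^sub>R coord ^ 2)"
proof -
  have "X - a *\<^sub>R 1 - b *\<^sub>R coord = c *\<^sub>R coord ^ 2 \<longleftrightarrow>
      X = a *\<^sub>R 1 + b *\<^sub>R coord + c *\<^sub>R coord ^ 2" for a b c
    by (auto simp: algebra_simps)
  then show ?thesis
    by (simp add: sl2_def span_insert span_breakdown_eq)
qed

lemma subspace_sl2: "subspace sl2"
  by (simp add: sl2_def)

lemma sl2_basis [simp]: "1 \<in> sl2" "coord \<in> sl2" "coord ^ 2 \<in> sl2"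
  by (auto simp: sl2_def intro: span_base)

lemma dx_coord_square [simp]: "dx (coord ^ 2) = 2 *\<^sub>R coord"
  by (simp add: dx_power)

lemma sl2_dx3: "X \<in> sl2 \<Longrightarrow> dx (dx (dx X)) = 0"
  by (auto simp: sl2_iff dx_linear)

lemma bracket_basis:
  "bracket 1 coord = 1" "bracket 1 (coord ^ 2) = 2 *\<^sub>R coord" "bracket coord (coord ^ 2) = coord ^ 2"
  by (simp_all add: bracket_def) (simp add: power2_eq_square scaleR_2 algebra_simps)

lemma sl2_bracket:
  assumes "X \<in> sl2" "Y \<in> sl2"
  shows "bracket X Y \<in> sl2"
proof -
  obtain a b c a' b' c' where
    "X = a *\<^sub>R 1 + b *\<^sub>R coord + c *\<^sub>R coord ^ 2" "Y = a' *\<^sub>R 1 + b' *\<^sub>R coord + c' *\<^sub>R coord ^ 2"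
    using assms by (auto simp: sl2_iff)
  then have "bracket X Y = (a * b' - b * a') *\<^sub>R 1 + (2 * a * c' - 2 * c * a') *\<^sub>R coord
      + (b * c' - c * b') *\<^sub>R coord ^ 2"
    by (intro smooth_fun_eqI)
       (simp add: bracket_def dx_linear smooth_fun_eval Rep_coord_square algebra_simps)
  then show ?thesis
    unfolding sl2_iff by blast
qed

lemma dx_bracket:
  assumes "X \<in> sl2" "Y \<in> sl2"
  shows "dx (bracket X Y) = X * dx (dx Y) - dx (dx X) * Y"
    and "dx (dx (bracket X Y)) = dx X * dx (dx Y) - dx (dx X) * dx Y"
  using assms by (simp_all add: bracket_def dx_linear dx_mult sl2_dx3)

subsection \<open>Coefficients of bidifferential operators\<close>

definition bounded_coeffs :: "nat \<Rightarrow> (nat \<Rightarrow> nat \<Rightarrow> smooth_fun) \<Rightarrow> bool" where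
  "bounded_coeffs n a \<longleftrightarrow> (\<forall>i j. n < i \<or> n < j \<longrightarrow> a i j = 0)"

definition finite_coeffs :: "(nat \<Rightarrow> nat \<Rightarrow> smooth_fun) set" where
  "finite_coeffs = {a. \<exists>n. bounded_coeffs n a}"

text \<open>Summing over the support avoids carrying an order bound; the support is finite for
  members of \<open>finite_coeffs\<close>.\<close>

definition bidiff :: "(nat \<Rightarrow> nat \<Rightarrow> smooth_fun) \<Rightarrow> bilin" where
  "bidiff a = (\<lambda>\<phi> \<psi>. \<Sum>(i, j)\<in>{(i, j). a i j \<noteq> 0}. a i j * (dx ^^ i) \<phi> * (dx ^^ j) \<psi>)"

text \<open>Well defined on \<open>bidiffops\<close> because \<open>bidiff\<close> is injective on
  \<open>finite_coeffs\<close>, see \<open>bidiff_eqE\<close>.\<close>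

definition bicoeff :: "bilin \<Rightarrow> nat \<Rightarrow> nat \<Rightarrow> smooth_fun" where
  "bicoeff A = (THE a. a \<in> finite_coeffs \<and> bidiff a = A)"

lemma bidiff_eq:
  assumes "bounded_coeffs n a"
  shows "bidiff a \<phi> \<psi> = (\<Sum>i\<le>n. \<Sum>j\<le>n. a i j * (dx ^^ i) \<phi> * (dx ^^ j) \<psi>)"
proof -
  have "i \<le> n \<and> j \<le> n" if "a i j \<noteq> 0" for i j
    using assms that by (meson bounded_coeffs_def not_le)
  then have "bidiff a \<phi> \<psi> = (\<Sum>(i, j)\<in>{..n} \<times> {..n}. a i j * (dx ^^ i) \<phi> * (dx ^^ j) \<psi>)"
    unfolding bidiff_def by (intro sum.mono_neutral_left) auto
  then show ?thesis
    by (simp add: sum.cartesian_product)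
qed

lemma bounded_coeffs_mono: "bounded_coeffs n a \<Longrightarrow> n \<le> m \<Longrightarrow> bounded_coeffs m a"
  by (auto simp: bounded_coeffs_def)

lemma common_bound:
  assumes "a \<in> finite_coeffs" "b \<in> finite_coeffs"
  obtains n where "bounded_coeffs n a" "bounded_coeffs n b"
  using assms bounded_coeffs_mono[OF _ max.cobounded1] bounded_coeffs_mono[OF _ max.cobounded2]
  unfolding finite_coeffs_def by blast

lemma bidiff_eqE:
  assumes "a \<in> finite_coeffs" "b \<in> finite_coeffs" "bidiff a = bidiff b"
  shows "a = b"
proof -
  obtain n where n: "bounded_coeffs n a" "bounded_coeffs n b"
    using assms common_bound by blast
  have "a p q = b p q" for p q
  proof (cases "p \<le> n \<and> q \<le> n")
    case True
    show ?thesis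
    proof (rule smooth_fun_eqI)
      fix y
      \<comment> \<open>testing on powers of \<open>x - y\<close> isolates the value of a single coefficient at \<open>y\<close>\<close>
      define u where "u = coord - y *\<^sub>R 1"
      have u: "dx u = 1" "Rep_smooth_fun u y = 0"
        by (simp_all add: u_def dx_linear smooth_fun_eval)
      have *: "Rep_smooth_fun (bidiff c (u ^ p) (u ^ q)) y = fact p * fact q * Rep_smooth_fun (c p q) y"
        if "bounded_coeffs n c" for c
      proof -
        have eval_sum: "Rep_smooth_fun (sum f S) y = (\<Sum>i\<in>S. Rep_smooth_fun (f i) y)"
          for f and S :: "nat set"
          by (induction S rule: infinite_finite_induct) (auto simp: smooth_fun_eval)
        have "Rep_smooth_fun (bidiff c (u ^ p) (u ^ q)) y =
            (\<Sum>i\<le>n. \<Sum>j\<le>n. if j = q then if i = p then fact p * fact q * Rep_smooth_fun (c i j) y else 0 else 0)"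
            (is "_ = ?R")
          unfolding bidiff_eq[OF that] eval_sum
          by (intro sum.cong refl)
             (simp add: smooth_fun_eval Rep_dx_funpow_shifted_power[OF u])
        also have "?R = fact p * fact q * Rep_smooth_fun (c p q) y"
          using True by simp
        finally show ?thesis .
      qed
      show "Rep_smooth_fun (a p q) y = Rep_smooth_fun (b p q) y"
        using *[OF n(1)] *[OF n(2)] assms(3) by simp
    qed
  next
    case False
    then show ?thesis using n by (auto simp: bounded_coeffs_def)
  qed
  then show ?thesis by blast
qed

lemma bicoeff_bidiff: "a \<in> finite_coeffs \<Longrightarrow> bicoeff (bidiff a) = a"
  unfolding bicoeff_def by (rule the_equality) (auto dest: bidiff_eqE)

lemma bidiffops_eq: "bidiffops = bidiff ` finite_coeffs"
proof (intro equalityI subsetI)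
  fix A assume "A \<in> bidiffops"
  then obtain n a where A: "A \<phi> \<psi> = (\<Sum>i\<le>n. \<Sum>j\<le>n. a i j * (dx ^^ i) \<phi> * (dx ^^ j) \<psi>)" for \<phi> \<psi>
    by (auto simp: bidiffops_def)
  define b where "b i j = (if i \<le> n \<and> j \<le> n then a i j else 0)" for i j
  have b: "bounded_coeffs n b"
    by (auto simp: bounded_coeffs_def b_def)
  then have "A = bidiff b"
    by (auto simp: fun_eq_iff A bidiff_eq b_def intro!: sum.cong)
  with b show "A \<in> bidiff ` finite_coeffs"
    by (auto simp: finite_coeffs_def)
next
  fix A assume "A \<in> bidiff ` finite_coeffs"
  then show "A \<in> bidiffops"
    using bidiff_eq unfolding bidiffops_def finite_coeffs_def by blast
qed

lemma bidiff_bicoeff: "A \<in> bidiffops \<Longrightarrow> bidiff (bicoeff A) = A"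
  and bicoeff_finite: "A \<in> bidiffops \<Longrightarrow> bicoeff A \<in> finite_coeffs"
  by (auto simp: bidiffops_eq bicoeff_bidiff)

lemma bidiff_in_bidiffops: "a \<in> finite_coeffs \<Longrightarrow> bidiff a \<in> bidiffops"
  by (auto simp: bidiffops_eq)

lemma subspace_finite_coeffs: "subspace finite_coeffs"
proof (rule subspaceI)
  show "0 \<in> finite_coeffs"
    by (auto simp: finite_coeffs_def bounded_coeffs_def)
  show "a + b \<in> finite_coeffs" if ab: "a \<in> finite_coeffs" "b \<in> finite_coeffs" for a b
  proof -
    obtain n where "bounded_coeffs n a" "bounded_coeffs n b"
      using common_bound[OF ab] .
    then have "bounded_coeffs n (a + b)"
      by (simp add: bounded_coeffs_def)
    then show ?thesis
      by (auto simp: finite_coeffs_def)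
  qed
  show "r *\<^sub>R a \<in> finite_coeffs" if "a \<in> finite_coeffs" for r a
    using that by (force simp: finite_coeffs_def bounded_coeffs_def scaleR_fun_apply)
qed

lemma bidiff_add:
  assumes "a \<in> finite_coeffs" "b \<in> finite_coeffs"
  shows "bidiff (a + b) = bidiff a + bidiff b"
proof -
  obtain n where n: "bounded_coeffs n a" "bounded_coeffs n b"
    using common_bound[OF assms] .
  then have "bounded_coeffs n (a + b)"
    by (simp add: bounded_coeffs_def)
  with n show ?thesis
    by (simp add: fun_eq_iff bidiff_eq sum.distrib algebra_simps)
qed

lemma bidiff_scaleR:
  assumes "a \<in> finite_coeffs"
  shows "bidiff (r *\<^sub>R a) = r *\<^sub>R bidiff a"
proof -
  obtain n where n: "bounded_coeffs n a"
    using assms by (auto simp: finite_coeffs_def)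
  then have "bounded_coeffs n (r *\<^sub>R a)"
    by (simp add: bounded_coeffs_def scaleR_fun_apply)
  with n show ?thesis
    by (simp add: fun_eq_iff bidiff_eq scaleR_fun_apply scaleR_sum_right)
qed

lemma subspace_bidiffops: "subspace bidiffops"
proof (rule subspaceI)
  have "bidiff 0 = 0"
    by (simp add: bidiff_def fun_eq_iff)
  then show "0 \<in> bidiffops"
    using bidiff_in_bidiffops subspace_0[OF subspace_finite_coeffs] by metis
qed (auto simp: bidiffops_eq bidiff_add[symmetric] bidiff_scaleR[symmetric]
       intro!: imageI subspace_add[OF subspace_finite_coeffs] subspace_scale[OF subspace_finite_coeffs])

lemma bicoeff_add:
  assumes "A \<in> bidiffops" "B \<in> bidiffops"
  shows "bicoeff (A + B) = bicoeff A + bicoeff B"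
  using assms subspace_add[OF subspace_finite_coeffs]
  by (auto simp: bidiffops_eq bidiff_add[symmetric] bicoeff_bidiff)

lemma bicoeff_scaleR: "A \<in> bidiffops \<Longrightarrow> bicoeff (r *\<^sub>R A) = r *\<^sub>R bicoeff A"
  using subspace_scale[OF subspace_finite_coeffs]
  by (auto simp: bidiffops_eq bidiff_scaleR[symmetric] bicoeff_bidiff)

lemma bicoeff_diff:
  assumes "A \<in> bidiffops" "B \<in> bidiffops"
  shows "bicoeff (A - B) = bicoeff A - bicoeff B"
  using bicoeff_add[of A "- B"] bicoeff_scaleR[of B "-1"] subspace_neg[OF subspace_bidiffops]
    assms by simp

subsection \<open>The action of sl(2) on coefficients\<close>

text \<open>The action transported to coefficients when X''' = 0. X' acts by the weight minus the
  order, X'' feeds order i + j + 1 into order i + j; its factors are those of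
  \<open>dx_funpow_lie_density\<close> at \<open>Suc i\<close> and \<open>Suc j\<close>.\<close>

definition lie_coeffs :: "real \<Rightarrow> real \<Rightarrow> real \<Rightarrow> smooth_fun \<Rightarrow>
    (nat \<Rightarrow> nat \<Rightarrow> smooth_fun) \<Rightarrow> nat \<Rightarrow> nat \<Rightarrow> smooth_fun" where
  "lie_coeffs l n m X a i j = X * dx (a i j) + (m - l - n - real i - real j) *\<^sub>R (dx X * a i j)
     - dx (dx X) * (((real i + 1) * (real i + 2 * l) / 2) *\<^sub>R a (Suc i) j
                  + ((real j + 1) * (real j + 2 * n) / 2) *\<^sub>R a i (Suc j))"

lemma linear_lie_density: "linear (lie_density l X)"
  by (rule linearI) (simp_all add: lie_density_def dx_linear algebra_simps)

text \<open>Leibniz rule cut off after X''. The last factor is i(i-1)/2 from X \<phi>' plus i l from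
  l X' \<phi>; it vanishes at i = 0, where the index i - 1 is truncated.\<close>

lemma dx_funpow_lie_density:
  assumes "dx (dx (dx X)) = 0"
  shows "(dx ^^ i) (lie_density l X \<phi>) = X * (dx ^^ Suc i) \<phi> + (real i + l) *\<^sub>R (dx X * (dx ^^ i) \<phi>)
    + (real i * (real i - 1 + 2 * l) / 2) *\<^sub>R (dx (dx X) * (dx ^^ (i - 1)) \<phi>)"
proof (induction i)
  case 0
  then show ?case by (simp add: lie_density_def)
next
  case (Suc i)
  show ?case
  proof (cases i)
    case 0
    then show ?thesis
      by (intro smooth_fun_eqI)
        (simp add: lie_density_def dx_linear dx_mult smooth_fun_eval algebra_simps)
  next
    case (Suc p)
    have "(dx ^^ Suc i) (lie_density l X \<phi>) = dx ((dx ^^ i) (lie_density l X \<phi>))"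
      by simp
    also note Suc.IH
    finally show ?thesis
      using Suc
      by (intro smooth_fun_eqI)
        (simp add: dx_linear dx_mult smooth_fun_eval assms algebra_simps add_divide_distrib)
  qed
qed

lemma lie_coeffs_bounded:
  assumes "bounded_coeffs k a"
  shows "bounded_coeffs k (lie_coeffs l n m X a)"
  unfolding bounded_coeffs_def
proof (intro allI impI)
  fix i j assume "k < i \<or> k < j"
  then have "a i j = 0" "a (Suc i) j = 0" "a i (Suc j) = 0"
    using assms by (auto simp: bounded_coeffs_def)
  then show "lie_coeffs l n m X a i j = 0"
    by (simp add: lie_coeffs_def dx_linear)
qed

lemma lie_coeffs_finite: "a \<in> finite_coeffs \<Longrightarrow> lie_coeffs l n m X a \<in> finite_coeffs"
  using lie_coeffs_bounded unfolding finite_coeffs_def by blast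

lemma sum_shift_down:
  fixes f :: "nat \<Rightarrow> 'a::comm_monoid_add"
  assumes "f 0 = 0" "f (Suc n) = 0"
  shows "(\<Sum>i\<le>n. f i) = (\<Sum>i\<le>n. f (Suc i))"
  using sum.atMost_Suc_shift[of f n] assms by simp

lemma lie_bidiffop_bidiff:
  assumes X: "X \<in> sl2" and a: "a \<in> finite_coeffs"
  shows "lie_bidiffop l n m X (bidiff a) = bidiff (lie_coeffs l n m X a)"
proof (intro ext)
  fix \<phi> \<psi>
  obtain k where k: "bounded_coeffs k a"
    using a by (auto simp: finite_coeffs_def)
  let ?p = "\<lambda>i. (dx ^^ i) \<phi>" and ?q = "\<lambda>i. (dx ^^ i) \<psi>"
  let ?r = "\<lambda>l i. real i * (real i - 1 + 2 * l) / 2"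
  note lie = dx_funpow_lie_density[OF sl2_dx3[OF X]]
  note bd = bidiff_eq[OF k] bidiff_eq[OF lie_coeffs_bounded[OF k]]
  have zero: "a (Suc k) j = 0" "a i (Suc k) = 0" for i j
    using k by (auto simp: bounded_coeffs_def)
  let ?S = "\<lambda>t. \<Sum>i\<le>k. \<Sum>j\<le>k. t i j"
  have "lie_density m X (bidiff a \<phi> \<psi>) = ?S (\<lambda>i j. lie_density m X (a i j * ?p i * ?q j))"
    unfolding bd by (simp add: linear_sum[OF linear_lie_density])
  then have "lie_bidiffop l n m X (bidiff a) \<phi> \<psi> = ?S (\<lambda>i j. lie_density m X (a i j * ?p i * ?q j)
      - a i j * (dx ^^ i) (lie_density l X \<phi>) * ?q j - a i j * ?p i * (dx ^^ j) (lie_density n X \<psi>))"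
    unfolding lie_bidiffop_def bd by (simp add: sum_subtractf)
  \<comment> \<open>The terms where X multiplies an extra derivative of \<phi> or \<psi> cancel
    between the action on the value and the actions on the arguments.\<close>
  also have "\<dots> = ?S (\<lambda>i j. (X * dx (a i j) + (m - l - n - real i - real j) *\<^sub>R (dx X * a i j)) * ?p i * ?q j
      - ?r l i *\<^sub>R (dx (dx X) * a i j * ?p (i - 1) * ?q j)
      - ?r n j *\<^sub>R (dx (dx X) * a i j * ?p i * ?q (j - 1)))"
    unfolding lie unfolding lie_density_def
    by (intro sum.cong refl smooth_fun_eqI) (simp add: dx_mult smooth_fun_eval algebra_simps add_divide_distrib diff_divide_distrib)
  also have "\<dots> = ?S (\<lambda>i j. (X * dx (a i j) + (m - l - n - real i - real j) *\<^sub>R (dx X * a i j)) * ?p i * ?q j)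
      - ?S (\<lambda>i j. ?r l i *\<^sub>R (dx (dx X) * a i j * ?p (i - 1) * ?q j))
      - ?S (\<lambda>i j. ?r n j *\<^sub>R (dx (dx X) * a i j * ?p i * ?q (j - 1)))"
    by (simp add: sum_subtractf)
  \<comment> \<open>Reindexing loses no term: \<open>?r\<close> vanishes at index 0 and the
    coefficients vanish at \<open>Suc k\<close>.\<close>
  also have "?S (\<lambda>i j. ?r l i *\<^sub>R (dx (dx X) * a i j * ?p (i - 1) * ?q j)) =
      ?S (\<lambda>i j. ?r l (Suc i) *\<^sub>R (dx (dx X) * a (Suc i) j * ?p i * ?q j))"
    by (subst sum_shift_down) (simp_all add: zero)
  also have "?S (\<lambda>i j. ?r n j *\<^sub>R (dx (dx X) * a i j * ?p i * ?q (j - 1))) =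
      ?S (\<lambda>i j. ?r n (Suc j) *\<^sub>R (dx (dx X) * a i (Suc j) * ?p i * ?q j))"
    by (subst sum_shift_down) (simp_all add: zero)
  also have "?S (\<lambda>i j. (X * dx (a i j) + (m - l - n - real i - real j) *\<^sub>R (dx X * a i j)) * ?p i * ?q j)
      - ?S (\<lambda>i j. ?r l (Suc i) *\<^sub>R (dx (dx X) * a (Suc i) j * ?p i * ?q j))
      - ?S (\<lambda>i j. ?r n (Suc j) *\<^sub>R (dx (dx X) * a i (Suc j) * ?p i * ?q j))
      = bidiff (lie_coeffs l n m X a) \<phi> \<psi>"
    unfolding bd sum_subtractf[symmetric] lie_coeffs_def
    by (intro sum.cong refl smooth_fun_eqI)
      (simp add: smooth_fun_eval algebra_simps add_divide_distrib diff_divide_distrib)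
  finally show "lie_bidiffop l n m X (bidiff a) \<phi> \<psi> = bidiff (lie_coeffs l n m X a) \<phi> \<psi>" .
qed

lemma lie_bidiffop_in_bidiffops: "X \<in> sl2 \<Longrightarrow> A \<in> bidiffops \<Longrightarrow> lie_bidiffop l n m X A \<in> bidiffops"
  by (auto simp: bidiffops_eq lie_bidiffop_bidiff lie_coeffs_finite)

lemma bicoeff_lie_bidiffop:
  "X \<in> sl2 \<Longrightarrow> A \<in> bidiffops \<Longrightarrow> bicoeff (lie_bidiffop l n m X A) = lie_coeffs l n m X (bicoeff A)"
  by (auto simp: bidiffops_eq lie_bidiffop_bidiff lie_coeffs_finite bicoeff_bidiff)

lemma linear_lie_bidiffop: "linear (lie_bidiffop l n m X)"
  by (rule linearI) (auto simp: lie_bidiffop_def fun_eq_iff scaleR_fun_apply algebra_simps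
      linear_add[OF linear_lie_density] linear_scale[OF linear_lie_density])

lemma lie_density_bracket:
  "lie_density l (bracket X Y) \<phi> =
     lie_density l X (lie_density l Y \<phi>) - lie_density l Y (lie_density l X \<phi>)"
  by (intro smooth_fun_eqI)
    (simp add: lie_density_def bracket_def dx_linear dx_mult smooth_fun_eval algebra_simps)

lemma bidiffop_diff:
  assumes "A \<in> bidiffops"
  shows "A (\<phi> - \<phi>') \<psi> = A \<phi> \<psi> - A \<phi>' \<psi>" "A \<phi> (\<psi> - \<psi>') = A \<phi> \<psi> - A \<phi> \<psi>'"
proof -
  obtain k a where "A \<phi> \<psi> = (\<Sum>i\<le>k. \<Sum>j\<le>k. a i j * (dx ^^ i) \<phi> * (dx ^^ j) \<psi>)" for \<phi> \<psi>
    using assms by (auto simp: bidiffops_def)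
  then show "A (\<phi> - \<phi>') \<psi> = A \<phi> \<psi> - A \<phi>' \<psi>" "A \<phi> (\<psi> - \<psi>') = A \<phi> \<psi> - A \<phi> \<psi>'"
    by (simp_all add: linear_diff[OF linear_dx_funpow] algebra_simps sum_subtractf)
qed

lemma lie_bidiffop_bracket:
  assumes "A \<in> bidiffops"
  shows "lie_bidiffop l n m (bracket X Y) A =
    lie_bidiffop l n m X (lie_bidiffop l n m Y A) - lie_bidiffop l n m Y (lie_bidiffop l n m X A)"
  by (intro ext) (simp add: lie_bidiffop_def lie_density_bracket bidiffop_diff[OF assms]
      linear_diff[OF linear_lie_density])

lemma linear_lie_density_field: "linear (\<lambda>X. lie_density l X \<phi>)"
  by (rule linearI) (simp_all add: lie_density_def dx_linear algebra_simps)

lemma lie_bidiffop_linear_field: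
  assumes "A \<in> bidiffops"
  shows "lie_bidiffop l n m (X + Y) A = lie_bidiffop l n m X A + lie_bidiffop l n m Y A"
    and "lie_bidiffop l n m (r *\<^sub>R X) A = r *\<^sub>R lie_bidiffop l n m X A"
proof -
  obtain k a where "A \<phi> \<psi> = (\<Sum>i\<le>k. \<Sum>j\<le>k. a i j * (dx ^^ i) \<phi> * (dx ^^ j) \<psi>)" for \<phi> \<psi>
    using assms by (auto simp: bidiffops_def)
  then have "A (\<phi> + \<phi>') \<psi> = A \<phi> \<psi> + A \<phi>' \<psi>" "A \<phi> (\<psi> + \<psi>') = A \<phi> \<psi> + A \<phi> \<psi>'"
    "A (r *\<^sub>R \<phi>) \<psi> = r *\<^sub>R A \<phi> \<psi>" "A \<phi> (r *\<^sub>R \<psi>) = r *\<^sub>R A \<phi> \<psi>" for \<phi> \<psi> \<phi>' \<psi>' r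
    by (simp_all add: linear_add[OF linear_dx_funpow] linear_scale[OF linear_dx_funpow]
        algebra_simps sum.distrib scaleR_sum_right)
  then show "lie_bidiffop l n m (X + Y) A = lie_bidiffop l n m X A + lie_bidiffop l n m Y A"
    and "lie_bidiffop l n m (r *\<^sub>R X) A = r *\<^sub>R lie_bidiffop l n m X A"
    by (auto simp: fun_eq_iff lie_bidiffop_def linear_add[OF linear_lie_density_field]
        linear_scale[OF linear_lie_density_field] scaleR_fun_apply algebra_simps)
qed

subsection \<open>Cocycles and coboundaries\<close>

text \<open>Differentiability in X is automatic on \<open>sl2\<close>: the algebra is
  finite-dimensional, and the coordinates of X are expressions in X, X' and X''.\<close>

lemma cochains_iff:
  "c \<in> cochains \<longleftrightarrow> (\<forall>X\<in>sl2. c X \<in> bidiffops) \<and>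
     (\<forall>X\<in>sl2. \<forall>Y\<in>sl2. c (X + Y) = c X + c Y) \<and>
     (\<forall>r. \<forall>X\<in>sl2. c (r *\<^sub>R X) = r *\<^sub>R c X) \<and>
     (\<forall>X. X \<notin> sl2 \<longrightarrow> c X = 0)" (is "_ \<longleftrightarrow> ?R")
proof
  assume R: ?R
  have add: "c (X + Y) = c X + c Y" if "X \<in> sl2" "Y \<in> sl2" for X Y
    using R that by blast
  have scale: "c (r *\<^sub>R X) = r *\<^sub>R c X" if "X \<in> sl2" for X r
    using R that by blast
  define a where "a X = bicoeff (c X)" for X
  have ex: "\<exists>n. bounded_coeffs n (a X)" if "X \<in> sl2" for X
    using R that bicoeff_finite[of "c X"] by (simp add: a_def finite_coeffs_def)
  obtain n1 n2 n3 where bounded: "bounded_coeffs n1 (a 1)" "bounded_coeffs n2 (a coord)"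
      "bounded_coeffs n3 (a (coord ^ 2))"
    using ex[OF sl2_basis(1)] ex[OF sl2_basis(2)] ex[OF sl2_basis(3)] by blast
  \<comment> \<open>The summand 2 makes room for the derivatives of X up to second order.\<close>
  define n where "n = 2 + n1 + n2 + n3"
  have n: "2 \<le> n" "bounded_coeffs n (a 1)" "bounded_coeffs n (a coord)"
      "bounded_coeffs n (a (coord ^ 2))"
    using bounded by (auto simp: n_def elim: bounded_coeffs_mono)
  have c: "c X \<phi> \<psi> = (\<Sum>i\<le>n. \<Sum>j\<le>n. a X i j * (dx ^^ i) \<phi> * (dx ^^ j) \<psi>)"
    if "X \<in> {1, coord, coord ^ 2}" for X \<phi> \<psi>
    using bidiff_eq[of n "a X" \<phi> \<psi>] n that R bidiff_bicoeff[of "c X"] by (auto simp: a_def)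
  \<comment> \<open>Taylor's formula: \<open>X - x X' + x\<^sup>2 X'' / 2\<close>, \<open>X' - x X''\<close> and \<open>X'' / 2\<close> are the (constant)
    coordinates of \<open>X\<close> in the basis of \<^const>\<open>sl2\<close>\<close>
  define b where "b r i j =
      (if r = 0 then a 1 i j
       else if r = 1 then a coord i j - coord * a 1 i j
       else if r = 2 then (1 / 2) *\<^sub>R (a (coord ^ 2) i j - 2 * coord * a coord i j + coord ^ 2 * a 1 i j)
       else 0)" for r :: nat and i j
  have "c X \<phi> \<psi> = (\<Sum>r\<le>n. \<Sum>i\<le>n. \<Sum>j\<le>n. b r i j * (dx ^^ r) X * (dx ^^ i) \<phi> * (dx ^^ j) \<psi>)"
    if "X \<in> sl2" for X \<phi> \<psi>
  proof -
    obtain p q r where X: "X = p *\<^sub>R 1 + q *\<^sub>R coord + r *\<^sub>R coord ^ 2"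
      using \<open>X \<in> sl2\<close> by (auto simp: sl2_iff)
    have "c X = p *\<^sub>R c 1 + q *\<^sub>R c coord + r *\<^sub>R c (coord ^ 2)"
      by (simp add: X add scale subspace_add[OF subspace_sl2] subspace_scale[OF subspace_sl2])
    then have "c X \<phi> \<psi> = p *\<^sub>R c 1 \<phi> \<psi> + q *\<^sub>R c coord \<phi> \<psi> + r *\<^sub>R c (coord ^ 2) \<phi> \<psi>"
      by (simp add: scaleR_fun_apply)
    also have "\<dots> = (\<Sum>i\<le>n. \<Sum>j\<le>n. (p *\<^sub>R a 1 i j + q *\<^sub>R a coord i j + r *\<^sub>R a (coord ^ 2) i j)
        * (dx ^^ i) \<phi> * (dx ^^ j) \<psi>)"
      by (simp add: c scaleR_sum_right sum.distrib algebra_simps)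
    also have "\<dots> = (\<Sum>i\<le>n. \<Sum>j\<le>n. (b 0 i j * X + b 1 i j * dx X + b 2 i j * dx (dx X))
        * (dx ^^ i) \<phi> * (dx ^^ j) \<psi>)"
      by (intro sum.cong refl arg_cong2[of _ _ _ _ times] smooth_fun_eqI)
        (simp add: b_def X dx_linear smooth_fun_eval Rep_coord_square algebra_simps)
    also have "\<dots> = (\<Sum>s\<in>{0, 1, 2}. \<Sum>i\<le>n. \<Sum>j\<le>n. b s i j * (dx ^^ s) X * (dx ^^ i) \<phi> * (dx ^^ j) \<psi>)"
      by (simp add: sum.distrib algebra_simps numeral_2_eq_2)
    also have "\<dots> = (\<Sum>s\<le>n. \<Sum>i\<le>n. \<Sum>j\<le>n. b s i j * (dx ^^ s) X * (dx ^^ i) \<phi> * (dx ^^ j) \<psi>)"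
      using n(1) by (intro sum.mono_neutral_left) (auto simp: b_def)
    finally show ?thesis .
  qed
  then show "c \<in> cochains"
    using R unfolding cochains_def by blast
qed (auto simp: cochains_def)

definition coboundary_map :: "real \<Rightarrow> real \<Rightarrow> real \<Rightarrow> bilin \<Rightarrow> smooth_fun \<Rightarrow> bilin" where
  "coboundary_map l n m B = (\<lambda>X. if X \<in> sl2 then lie_bidiffop l n m X B else 0)"

lemma coboundaries_eq: "coboundaries l n m = coboundary_map l n m ` bidiffops"
  by (auto simp: coboundaries_def coboundary_map_def)

lemma linear_coboundary_map: "linear (coboundary_map l n m)"
  by (rule linearI) (auto simp: coboundary_map_def fun_eq_iff scaleR_fun_apply
      linear_add[OF linear_lie_bidiffop] linear_scale[OF linear_lie_bidiffop])

lemma subspace_coboundaries: "subspace (coboundaries l n m)"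
  unfolding coboundaries_eq by (rule linear_subspace_image[OF linear_coboundary_map subspace_bidiffops])

lemma coboundaries_subset_cocycles: "coboundaries l n m \<subseteq> cocycles l n m"
proof
  fix c assume "c \<in> coboundaries l n m"
  then obtain B where "B \<in> bidiffops" "c = coboundary_map l n m B"
    by (auto simp: coboundaries_eq)
  then show "c \<in> cocycles l n m"
    by (auto simp: cocycles_def cochains_iff coboundary_map_def lie_bidiffop_in_bidiffops
        lie_bidiffop_linear_field lie_bidiffop_bracket sl2_bracket
        subspace_add[OF subspace_sl2] subspace_scale[OF subspace_sl2])
qed

lemma cocycle_bidiffop: "c \<in> cocycles l n m \<Longrightarrow> X \<in> sl2 \<Longrightarrow> c X \<in> bidiffops"
  by (auto simp: cocycles_def cochains_def)

lemma subspace_cocycles: "subspace (cocycles l n m)"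
proof -
  note simps = linear_add[OF linear_lie_bidiffop] linear_scale[OF linear_lie_bidiffop]
    linear_0[OF linear_lie_bidiffop]
  have "subspace cochains"
    by (rule subspaceI)
      (auto simp: cochains_iff subspace_0[OF subspace_bidiffops] subspace_add[OF subspace_bidiffops]
        subspace_scale[OF subspace_bidiffops] scaleR_fun_apply scaleR_add_right add_ac scaleR_left_commute)
  then show ?thesis
    by (intro subspaceI)
      (simp_all add: cocycles_def subspace_0 subspace_add subspace_scale simps scaleR_fun_apply
        scaleR_diff_right add_diff_add)
qed

lemma cocycle_eq_0:
  assumes "c \<in> cocycles l n m" "c 1 = 0" "c coord = 0" "c (coord ^ 2) = 0"
  shows "c = 0"
proof (rule ext)
  fix X
  have c: "c \<in> cochains"
    using assms(1) by (simp add: cocycles_def)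
  show "c X = 0 X"
  proof (cases "X \<in> sl2")
    case True
    then obtain p q r where "X = p *\<^sub>R 1 + q *\<^sub>R coord + r *\<^sub>R coord ^ 2"
      by (auto simp: sl2_iff)
    with c show ?thesis
      by (simp add: cochains_iff assms subspace_add[OF subspace_sl2] subspace_scale[OF subspace_sl2])
  qed (use c in \<open>auto simp: cochains_iff\<close>)
qed

lemma cocycle_bicoeff:
  assumes "c \<in> cocycles l n m" "X \<in> sl2" "Y \<in> sl2"
  shows "bicoeff (c (bracket X Y)) i j =
    lie_coeffs l n m X (bicoeff (c Y)) i j - lie_coeffs l n m Y (bicoeff (c X)) i j"
  using assms cocycle_bidiffop[OF assms(1)]
  by (simp add: cocycles_def bicoeff_diff bicoeff_lie_bidiffop lie_bidiffop_in_bidiffops)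

section \<open>The cocycle condition at the origin as a bidiagonal system\<close>

text \<open>
  The entry \<open>a i\<close> stands for the coefficient of \<open>\<phi>\<^sup>(\<^sup>i\<^sup>) \<psi>\<^sup>(\<^sup>k\<^sup>-\<^sup>i\<^sup>)\<close>, and row \<open>i < k\<close> of the result for that
  of \<open>\<phi>\<^sup>(\<^sup>i\<^sup>) \<psi>\<^sup>(\<^sup>k\<^sup>-\<^sup>1\<^sup>-\<^sup>i\<^sup>)\<close>.
\<close>

definition bidiagonal :: "real \<Rightarrow> real \<Rightarrow> nat \<Rightarrow> (nat \<Rightarrow> real) \<Rightarrow> nat \<Rightarrow> real" where
  "bidiagonal l n k a i = (real i + 1) * (real i + 2 * l) * a (Suc i)
     + (real k - real i) * (real k - real i - 1 + 2 * n) * a i"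

lemma lie_coeffs_1: "lie_coeffs l n m 1 a i j = dx (a i j)"
  by (simp add: lie_coeffs_def dx_linear)

lemma lie_coeffs_coord_0:
  "Rep_smooth_fun (lie_coeffs l n m coord a i j) 0 =
     (m - l - n - real i - real j) * Rep_smooth_fun (a i j) 0"
  by (simp add: lie_coeffs_def dx_linear smooth_fun_eval)

text \<open>Both x^2 and its derivative vanish at 0, so only the X'' part survives: this is minus
  the map T.\<close>

lemma lie_coeffs_coord_square_0:
  "Rep_smooth_fun (lie_coeffs l n m (coord ^ 2) a i j) 0 =
     - ((real i + 1) * (real i + 2 * l) * Rep_smooth_fun (a (Suc i) j) 0
      + (real j + 1) * (real j + 2 * n) * Rep_smooth_fun (a i (Suc j)) 0)"
  by (simp add: lie_coeffs_def dx_linear smooth_fun_eval Rep_coord_square)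

text \<open>Evaluate the condition for [x, x^2] = x^2 at 0 in order k - 1. The Euler weight there is
  1, so the values of \<open>c (coord ^ 2)\<close> cancel and T C = 0 remains.\<close>

lemma cocycle_bidiagonal:
  assumes c: "c \<in> cocycles l n m" and k: "m - l - n = real k" and i: "i < k"
  shows "bidiagonal l n k (\<lambda>i. Rep_smooth_fun (bicoeff (c coord) i (k - i)) 0) i = 0"
proof -
  let ?j = "k - Suc i"
  have "Suc ?j = k - i" "real ?j = real k - real i - 1"
    using i by auto
  with arg_cong[OF cocycle_bicoeff[OF c sl2_basis(2, 3), of i ?j], of "\<lambda>f. Rep_smooth_fun f 0"]
  show ?thesis
    by (simp add: bracket_basis k smooth_fun_eval lie_coeffs_coord_0 lie_coeffs_coord_square_0
        bidiagonal_def)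
qed

text \<open>An operator is built whose coboundary agrees with \<open>c\<close> on the three
  generators. Quantifying the hypotheses over \<open>k\<close> makes them vacuous when
  \<open>m - l - n\<close> is not a natural number.\<close>

lemma coboundaryI:
  assumes c: "c \<in> cocycles l n m"
    and C: "\<And>k i. m - l - n = real k \<Longrightarrow> i \<le> k \<Longrightarrow> Rep_smooth_fun (bicoeff (c coord) i (k - i)) 0 = 0"
    and E: "\<And>k. m - l - n = real k \<Longrightarrow>
      \<exists>a. \<forall>i<k. Rep_smooth_fun (bicoeff (c (coord ^ 2)) i (k - Suc i)) 0 = bidiagonal l n k a i"
  shows "c \<in> coboundaries l n m"
proof -
  \<comment> \<open>At most one \<open>k\<close> occurs, so a single \<open>a\<close> serves; if
    none occurs, any \<open>a\<close> will do.\<close>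
  obtain a where a: "Rep_smooth_fun (bicoeff (c (coord ^ 2)) i (k - Suc i)) 0 = bidiagonal l n k a i"
    if "m - l - n = real k" "i < k" for k i
  proof (cases "\<exists>k. m - l - n = real k")
    case True
    then obtain k where k: "m - l - n = real k" ..
    from E[OF this] obtain a
      where "\<forall>i<k. Rep_smooth_fun (bicoeff (c (coord ^ 2)) i (k - Suc i)) 0 = bidiagonal l n k a i" ..
    with k that show ?thesis by (metis of_nat_eq_iff)
  qed (use that in blast)
  have "\<forall>i j. \<exists>F. dx F = bicoeff (c 1) i j \<and> Rep_smooth_fun F 0 = 0"
    using antiderivative_exists by blast
  then obtain F where F: "dx (F i j) = bicoeff (c 1) i j" "Rep_smooth_fun (F i j) 0 = 0" for i j
    by metis
  \<comment> \<open>\<open>F\<close> cancels \<open>c\<close> on \<open>d/dx\<close>; the constants \<open>b0\<close> cancel the values at \<open>0\<close> on the other two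
    generators\<close>
  define b0 where "b0 i j = (if m - l - n = real i + real j then - a i
      else Rep_smooth_fun (bicoeff (c coord) i j) 0 / (m - l - n - real i - real j))" for i j
  define b where "b i j = F i j + b0 i j *\<^sub>R 1" for i j
  have b_0: "Rep_smooth_fun (b i j) 0 = b0 i j" for i j
    by (simp add: b_def smooth_fun_eval F)
  have "b \<in> finite_coeffs"
  proof -
    have "bicoeff (c 1) \<in> finite_coeffs" "bicoeff (c coord) \<in> finite_coeffs"
      using cocycle_bidiffop[OF c] by (auto intro!: bicoeff_finite)
    then obtain N where N: "bounded_coeffs N (bicoeff (c 1))" "bounded_coeffs N (bicoeff (c coord))"
      using common_bound by blast
    \<comment> \<open>Beyond \<open>M\<close> the order exceeds \<open>m - l - n\<close>, so the
      exceptional branch of \<open>b0\<close> cannot occur.\<close>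
    define M where "M = max N (nat \<lceil>m - l - n\<rceil>)"
    have "b i j = 0" if "M < i \<or> M < j" for i j
    proof -
      have "dx (F i j) = 0" "bicoeff (c coord) i j = 0"
        using N that by (auto simp: F M_def bounded_coeffs_def)
      moreover from this have "F i j = 0"
        using dx_eq_0_iff[of "F i j"] F(2)[of i j] by simp
      moreover have "m - l - n \<noteq> real i + real j"
        using that unfolding M_def by linarith
      ultimately show ?thesis
        by (simp add: b_def b0_def zero_smooth_fun.rep_eq)
    qed
    then show ?thesis
      unfolding finite_coeffs_def bounded_coeffs_def by blast
  qed
  then have B: "bidiff b \<in> bidiffops" and bB: "bicoeff (bidiff b) = b"
    by (auto simp: bidiff_in_bidiffops bicoeff_bidiff)
  define d where "d = c - coboundary_map l n m (bidiff b)"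
  have cob: "coboundary_map l n m (bidiff b) \<in> coboundaries l n m"
    using B by (auto simp: coboundaries_eq)
  have d: "d \<in> cocycles l n m"
    unfolding d_def using c cob coboundaries_subset_cocycles subspace_diff[OF subspace_cocycles] by blast
  have dX: "bicoeff (d X) i j = bicoeff (c X) i j - lie_coeffs l n m X b i j" if "X \<in> sl2" for X i j
    using that B cocycle_bidiffop[OF c that]
    by (simp add: d_def coboundary_map_def bicoeff_diff bicoeff_lie_bidiffop lie_bidiffop_in_bidiffops bB)
  have zeroI: "d X = 0" if "X \<in> sl2" "\<And>i j. bicoeff (d X) i j = 0" for X
  proof -
    have "bicoeff (d X) = 0"
      using that(2) by (intro ext) simp
    then show ?thesis
      using bidiff_bicoeff[OF cocycle_bidiffop[OF d that(1)]] by (simp add: bidiff_def fun_eq_iff)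
  qed
  have bicoeff_0: "bicoeff 0 i j = 0" for i j
    using bicoeff_scaleR[OF subspace_0[OF subspace_bidiffops], of 0] by simp
  have lie_0: "lie_coeffs l n m X (bicoeff 0) i j = 0" for X i j
    by (simp add: lie_coeffs_def bicoeff_0 dx_linear)
  have d1: "d 1 = 0"
    by (rule zeroI) (simp_all add: dX lie_coeffs_1 b_def dx_linear F)
  have dcoord: "d coord = 0"
  proof (rule zeroI)
    fix i j
    \<comment> \<open>From [1, x] = 1 and \<open>d 1 = 0\<close>.\<close>
    have "dx (bicoeff (d coord) i j) = 0"
      using cocycle_bicoeff[OF d sl2_basis(1, 2), of i j]
      by (simp add: bracket_basis d1 lie_0 lie_coeffs_1 bicoeff_0)
    moreover have "Rep_smooth_fun (bicoeff (d coord) i j) 0 = 0"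
    proof (cases "m - l - n = real i + real j")
      case True
      with C[of "i + j" i] show ?thesis
        by (simp add: dX smooth_fun_eval lie_coeffs_coord_0)
    next
      case False
      then show ?thesis
        by (simp add: dX smooth_fun_eval lie_coeffs_coord_0 b_0 b0_def)
    qed
    ultimately show "bicoeff (d coord) i j = 0"
      using dx_eq_0_iff[of "bicoeff (d coord) i j"] by simp
  qed simp
  have "d (coord ^ 2) = 0"
  proof (rule zeroI)
    fix i j
    let ?a = "bicoeff (d (coord ^ 2)) i j"
    \<comment> \<open>From [1, x^2] = 2x, as \<open>d\<close> vanishes on both 1 and x.\<close>
    have const: "dx ?a = 0"
      using cocycle_bicoeff[OF d sl2_basis(1, 3), of i j] dcoord d
        lie_0[of "coord ^ 2"]
      by (simp add: bracket_basis d1 lie_coeffs_1 bicoeff_0 cocycles_def cochains_iff)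
    have "Rep_smooth_fun ?a 0 = 0"
    proof (cases "m - l - n = real (i + j + 1)")
      case True
      \<comment> \<open>Both neighbouring entries have order k, hence are given by
        \<open>- a\<close>; the sign compensates that x^2 acts by -T.\<close>
      then have "m - l - n = real (Suc i) + real j" "m - l - n = real i + real (Suc j)"
        by auto
      with a[OF True, of i] show ?thesis
        by (simp add: dX smooth_fun_eval lie_coeffs_coord_square_0 b_0 b0_def bidiagonal_def algebra_simps)
    next
      case False
      \<comment> \<open>Outside order k - 1, the relation [x, x^2] = x^2 multiplies the value by a
        weight other than 1, forcing it to be 0.\<close>
      have "Rep_smooth_fun ?a 0 = (m - l - n - real i - real j) * Rep_smooth_fun ?a 0"
        using arg_cong[OF cocycle_bicoeff[OF d sl2_basis(2, 3), of i j], of "\<lambda>f. Rep_smooth_fun f 0"]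
        by (simp add: bracket_basis dcoord lie_0 smooth_fun_eval lie_coeffs_coord_0)
      moreover have "m - l - n - real i - real j \<noteq> 1"
        using False by auto
      ultimately show ?thesis by simp
    qed
    with const show "?a = 0"
      using dx_eq_0_iff[of ?a] by simp
  qed simp
  then have "d = 0"
    using cocycle_eq_0[OF d d1 dcoord] by blast
  with cob show ?thesis
    by (simp add: d_def)
qed

text \<open>Realises every C in ker T together with an arbitrary E by the cocycle X' C + X'' E /
  2.\<close>

lemma cocycle_exists:
  assumes k: "m - l - n = real k" and C: "\<And>i. i < k \<Longrightarrow> bidiagonal l n k C i = 0"
  shows "\<exists>c\<in>cocycles l n m.
    (\<forall>i\<le>k. Rep_smooth_fun (bicoeff (c coord) i (k - i)) 0 = C i) \<and>
    (\<forall>i<k. Rep_smooth_fun (bicoeff (c (coord ^ 2)) i (k - Suc i)) 0 = E i)"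
proof -
  \<comment> \<open>Halving \<open>E i\<close> compensates for (x^2)'' = 2.\<close>
  define u where "u X i j = (if i + j = k then C i *\<^sub>R dx X
      else if Suc (i + j) = k then (E i / 2) *\<^sub>R dx (dx X) else 0)" for X i j
  define c where "c X = (if X \<in> sl2 then bidiff (u X) else 0)" for X
  have fin: "u X \<in> finite_coeffs" for X
    unfolding finite_coeffs_def bounded_coeffs_def by (auto simp: u_def intro!: exI[of _ k])
  have u_add: "u (X + Y) = u X + u Y" and u_scale: "u (r *\<^sub>R X) = r *\<^sub>R u X" for X Y r
    by (auto simp: u_def fun_eq_iff dx_linear scaleR_fun_apply algebra_simps)
  have "u (bracket X Y) = lie_coeffs l n m X (u Y) - lie_coeffs l n m Y (u X)"
    if XY: "X \<in> sl2" "Y \<in> sl2" for X Y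
  proof (intro ext)
    fix i j
    consider "i + j = k" | "Suc (i + j) = k" | "i + j \<noteq> k" "Suc (i + j) \<noteq> k" by blast
    then show "u (bracket X Y) i j = (lie_coeffs l n m X (u Y) - lie_coeffs l n m Y (u X)) i j"
    proof cases
      case 1
      \<comment> \<open>In order k the weight is 0, leaving C (X Y'' - X'' Y), which is C times the
        derivative of the bracket.\<close>
      then show ?thesis
        by (intro smooth_fun_eqI)
          (auto simp: u_def lie_coeffs_def k dx_bracket[OF XY] dx_linear smooth_fun_eval algebra_simps)
    next
      case 2
      \<comment> \<open>In order k - 1 the condition T C = 0 removes the X'' part, and weight 1
        yields the second derivative of the bracket.\<close>
      have "(real i + 1) * (real i + 2 * l) * C (Suc i) + (real j + 1) * (real j + 2 * n) * C i = 0"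
        using C[of i] 2 by (auto simp: bidiagonal_def add.commute)
      then have "((real i + 1) * (real i + 2 * l) / 2 * C (Suc i) +
          (real j + 1) * (real j + 2 * n) / 2 * C i) = 0"
        by argo
      then have 0: "((real i + 1) * (real i + 2 * l) / 2) *\<^sub>R u Z (Suc i) j +
          ((real j + 1) * (real j + 2 * n) / 2) *\<^sub>R u Z i (Suc j) = 0" for Z
        using 2 by (simp add: u_def scaleR_add_left[symmetric])
      have "m - l - n - real i - real j = 1"
        using k 2 by auto
      then show ?thesis
        using 2 unfolding fun_diff_def lie_coeffs_def 0
        by (intro smooth_fun_eqI)
          (auto simp: u_def dx_bracket[OF XY] dx_linear dx_mult sl2_dx3 XY smooth_fun_eval algebra_simps)
    next
      case 3
      \<comment> \<open>In order k - 2 the contributions are multiples of X'' Y'' and cancel by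
        antisymmetry; in all other orders they are 0.\<close>
      then show ?thesis
        by (intro smooth_fun_eqI)
          (auto simp: u_def lie_coeffs_def dx_linear smooth_fun_eval algebra_simps)
    qed
  qed
  then have "bidiff (u (bracket X Y)) =
      bidiff (lie_coeffs l n m X (u Y)) - bidiff (lie_coeffs l n m Y (u X))"
    if "X \<in> sl2" "Y \<in> sl2" for X Y
    using that bidiff_add[OF fin lie_coeffs_finite[OF fin], of "bracket X Y" l n m Y X]
    by (simp add: algebra_simps)
  then have "c \<in> cocycles l n m"
    by (simp add: cocycles_def cochains_iff c_def bidiff_in_bidiffops fin u_add u_scale bidiff_add
        bidiff_scaleR subspace_add[OF subspace_sl2] subspace_scale[OF subspace_sl2] sl2_bracket
        lie_bidiffop_bidiff)
  then show ?thesis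
    by (intro bexI[of _ c]) (auto simp: c_def bicoeff_bidiff[OF fin] u_def dx_linear smooth_fun_eval)
qed

section \<open>Passage from cocycles to the quotient\<close>

text \<open>The first isomorphism theorem for quotients encoded as sets of cosets.\<close>

lemma quotient_isomorphicI:
  assumes V: "subspace V" and U: "subspace U" "U \<subseteq> V"
    and add: "\<And>v w. v \<in> V \<Longrightarrow> w \<in> V \<Longrightarrow> F (v + w) = F v + F w"
    and scale: "\<And>r v. v \<in> V \<Longrightarrow> F (r *\<^sub>R v) = r *\<^sub>R F v"
    and W: "F ` V = W" and ker: "\<And>v. v \<in> V \<Longrightarrow> F v = 0 \<longleftrightarrow> v \<in> U"
  shows "quotient_isomorphic V U W"
proof -
  \<comment> \<open>\<open>F\<close> is constant on each coset, so the image is a singleton and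
    \<open>the_elem\<close> extracts its value.\<close>
  define f where "f P = the_elem (F ` P)" for P
  have f: "f (v +o U) = F v" if "v \<in> V" for v
  proof -
    have "F (v + u) = F v" if "u \<in> U" for u
      using add[OF \<open>v \<in> V\<close>, of u] U ker[of u] that by auto
    moreover have "v \<in> v +o U"
      using subspace_0[OF U(1)] by (force simp: elt_set_plus_def)
    ultimately have "F ` (v +o U) = {F v}"
      by (auto simp: elt_set_plus_def)
    then show ?thesis by (simp add: f_def)
  qed
  have UU: "U + U = U"
    using subspace_add[OF U(1)] subspace_0[OF U(1)] by (force simp: set_plus_def)
  have coset_eq: "v +o U = w +o U" if "v \<in> V" "w \<in> V" "F v = F w" for v w
  proof -
    have "v - w \<in> V"
      using that subspace_diff[OF V] by blast
    moreover from this have "F (v - w) = 0"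
      using add[of "v - w" w] that by simp
    ultimately have "v - w \<in> U"
      using ker by blast
    moreover from this have "w - v \<in> U"
      using subspace_neg[OF U(1)] by fastforce
    ultimately have "\<exists>b\<in>U. v + u = w + b" "\<exists>b\<in>U. w + u = v + b" if "u \<in> U" for u
      using that subspace_add[OF U(1)]
      by (auto intro: bexI[of _ "v - w + u"] bexI[of _ "w - v + u"])
    then show ?thesis
      by (fastforce simp: elt_set_plus_def)
  qed
  have "bij_betw f (quotient_space V U) W"
  proof (rule bij_betw_imageI)
    show "inj_on f (quotient_space V U)"
    proof (rule inj_onI)
      fix P Q assume "P \<in> quotient_space V U" "Q \<in> quotient_space V U" "f P = f Q"
      then obtain v w where "v \<in> V" "P = v +o U" "w \<in> V" "Q = w +o U"
        by (auto simp: quotient_space_def)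
      with \<open>f P = f Q\<close> show "P = Q"
        using coset_eq[of v w] f by simp
    qed
    show "f ` quotient_space V U = W"
      using W by (force simp: quotient_space_def f image_iff)
  qed
  moreover have "f (P + Q) = f P + f Q" if "P \<in> quotient_space V U" "Q \<in> quotient_space V U" for P Q
    using that by (auto simp: quotient_space_def set_plus_rearrange UU f add subspace_add[OF V])
  moreover have "f (coset_scaleR U r P) = r *\<^sub>R f P" if P: "P \<in> quotient_space V U" for r P
  proof -
    obtain v where v: "v \<in> V" "P = v +o U"
      using P by (auto simp: quotient_space_def)
    have "coset_scaleR U r P = (r *\<^sub>R v) +o U"
    proof (intro equalityI subsetI)
      fix x assume "x \<in> coset_scaleR U r P"
      then obtain u u' where "u \<in> U" "u' \<in> U" "x = r *\<^sub>R (v + u) + u'"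
        by (auto simp: coset_scaleR_def v elt_set_plus_def set_plus_def)
      then show "x \<in> (r *\<^sub>R v) +o U"
        using subspace_add[OF U(1) subspace_scale[OF U(1)]]
        by (auto simp: elt_set_plus_def scaleR_add_right add.assoc)
    next
      fix x assume "x \<in> (r *\<^sub>R v) +o U"
      then show "x \<in> coset_scaleR U r P"
        using subspace_0[OF U(1)]
        by (force simp: coset_scaleR_def v elt_set_plus_def set_plus_def)
    qed
    then show ?thesis
      by (simp add: f v subspace_scale[OF V] scale)
  qed
  ultimately show ?thesis
    unfolding quotient_isomorphic_def by blast
qed

text \<open>Reduces the cohomology to linear algebra: \<open>f\<close> has to induce an isomorphism
  from ker T plus coker T onto the target.\<close>

lemma H1_isomorphicI:
  fixes f :: "(nat \<Rightarrow> real) \<times> (nat \<Rightarrow> real) \<Rightarrow> 'b::real_vector"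
  assumes k: "m - l - n = real k" and f: "linear f"
    and ker: "\<And>C E. (\<And>i. i < k \<Longrightarrow> bidiagonal l n k C i = 0) \<Longrightarrow>
      f (C, E) = 0 \<longleftrightarrow> (\<forall>i\<le>k. C i = 0) \<and> (\<exists>a. \<forall>i<k. E i = bidiagonal l n k a i)"
    and surj: "\<And>w. \<exists>C E. (\<forall>i<k. bidiagonal l n k C i = 0) \<and> f (C, E) = w"
  shows "H1_isomorphic l n m (UNIV :: 'b set)"
proof -
  define C where "C c = (\<lambda>i. Rep_smooth_fun (bicoeff (c coord) i (k - i)) 0)"
    for c :: "smooth_fun \<Rightarrow> bilin"
  define E where "E c = (\<lambda>i. Rep_smooth_fun (bicoeff (c (coord ^ 2)) i (k - Suc i)) 0)"
    for c :: "smooth_fun \<Rightarrow> bilin"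
  note bidiffop = cocycle_bidiffop[of _ l n m]
  have kernel: "bidiagonal l n k (C c) i = 0" if "c \<in> cocycles l n m" "i < k" for c i
    using cocycle_bidiagonal[OF that(1) k that(2)] by (simp add: C_def)
  have "quotient_isomorphic (cocycles l n m) (coboundaries l n m) (UNIV :: 'b set)"
  proof (rule quotient_isomorphicI[OF subspace_cocycles subspace_coboundaries
      coboundaries_subset_cocycles, where F = "\<lambda>c. f (C c, E c)"])
    fix c d assume cd: "c \<in> cocycles l n m" "d \<in> cocycles l n m"
    have "C (c + d) = C c + C d" "E (c + d) = E c + E d"
      using cd by (auto simp: C_def E_def fun_eq_iff bicoeff_add bidiffop smooth_fun_eval)
    then show "f (C (c + d), E (c + d)) = f (C c, E c) + f (C d, E d)"
      by (simp add: linear_add[OF f, symmetric])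
  next
    fix r c assume c: "c \<in> cocycles l n m"
    have "C (r *\<^sub>R c) = r *\<^sub>R C c" "E (r *\<^sub>R c) = r *\<^sub>R E c"
      using c bicoeff_scaleR[OF bidiffop]
      by (auto simp: C_def E_def fun_eq_iff scaleR_fun_apply smooth_fun_eval)
    then show "f (C (r *\<^sub>R c), E (r *\<^sub>R c)) = r *\<^sub>R f (C c, E c)"
      by (simp add: linear_scale[OF f, symmetric])
  next
    have "w \<in> (\<lambda>c. f (C c, E c)) ` cocycles l n m" for w
    proof -
      obtain C0 E0 where w: "\<forall>i<k. bidiagonal l n k C0 i = 0" "f (C0, E0) = w"
        using surj by blast
      then obtain c where c: "c \<in> cocycles l n m" "\<forall>i\<le>k. C c i = C0 i" "\<forall>i<k. E c i = E0 i"
        using cocycle_exists[OF k, of C0 E0] unfolding C_def E_def by auto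
      \<comment> \<open>The two pairs agree only on the relevant indices; \<open>ker\<close> shows
        that \<open>f\<close> ignores the rest.\<close>
      have "f (C c - C0, E c - E0) = 0"
        by (subst ker) (auto simp: c bidiagonal_def intro!: exI[of _ "\<lambda>_. 0"])
      then have "f (C c, E c) = w"
        using linear_diff[OF f, of "(C c, E c)" "(C0, E0)"] w(2) by simp
      with c(1) show ?thesis by (auto intro: image_eqI[of _ _ c])
    qed
    then show "(\<lambda>c. f (C c, E c)) ` cocycles l n m = UNIV" by blast
  next
    fix c assume c: "c \<in> cocycles l n m"
    have "f (C c, E c) = 0 \<longleftrightarrow> (\<forall>i\<le>k. C c i = 0) \<and> (\<exists>a. \<forall>i<k. E c i = bidiagonal l n k a i)"
      by (rule ker) (rule kernel[OF c])
    also have "\<dots> \<longleftrightarrow> c \<in> coboundaries l n m"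
    proof
      assume "(\<forall>i\<le>k. C c i = 0) \<and> (\<exists>a. \<forall>i<k. E c i = bidiagonal l n k a i)"
      then show "c \<in> coboundaries l n m"
        unfolding C_def E_def using k by (intro coboundaryI[OF c]) auto
    next
      assume "c \<in> coboundaries l n m"
      then obtain B where B: "B \<in> bidiffops" "c = coboundary_map l n m B"
        by (auto simp: coboundaries_eq)
      have cX: "bicoeff (c X) = lie_coeffs l n m X (bicoeff B)" if "X \<in> sl2" for X
        using that B by (simp add: coboundary_map_def bicoeff_lie_bidiffop)
      \<comment> \<open>The sign appears because x^2 acts by -T.\<close>
      let ?a = "\<lambda>i. - Rep_smooth_fun (bicoeff B i (k - i)) 0"
      have "C c i = 0" if "i \<le> k" for i
        using that k by (simp add: C_def cX lie_coeffs_coord_0)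
      moreover have "E c i = bidiagonal l n k ?a i" if "i < k" for i
      proof -
        have "Suc (k - Suc i) = k - i" "real (k - Suc i) = real k - real i - 1"
          using that by auto
        then show ?thesis
          by (simp add: E_def cX lie_coeffs_coord_square_0 bidiagonal_def algebra_simps)
      qed
      ultimately show "(\<forall>i\<le>k. C c i = 0) \<and> (\<exists>a. \<forall>i<k. E c i = bidiagonal l n k a i)"
        by blast
    qed
    finally show "f (C c, E c) = 0 \<longleftrightarrow> c \<in> coboundaries l n m" .
  qed
  then show ?thesis
    by (simp add: H1_isomorphic_def)
qed

text \<open>No order \<open>k\<close> exists, so \<open>coboundaryI\<close> applies to every
  cocycle.\<close>

lemma H1_trivial:
  assumes "m - l - n \<notin> \<nat>"
  shows "H1_isomorphic l n m ({0} :: real set)"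
  unfolding H1_isomorphic_def
proof (rule quotient_isomorphicI[OF subspace_cocycles subspace_coboundaries
      coboundaries_subset_cocycles, where F = "\<lambda>_. 0"])
  show "(\<lambda>_. 0) ` cocycles l n m = {0 :: real}"
    using subspace_0[OF subspace_cocycles] by auto
  show "0 = (0 :: real) \<longleftrightarrow> c \<in> coboundaries l n m" if "c \<in> cocycles l n m" for c
    using coboundaryI[OF that] assms by (metis of_nat_in_Nats)
qed auto

subsection \<open>Bidiagonal linear systems\<close>

lemma bidiagonal_extend:
  fixes p q e :: "nat \<Rightarrow> real"
  assumes "m \<le> k" "\<And>i. m \<le> i \<Longrightarrow> i < k \<Longrightarrow> p i \<noteq> 0" "\<forall>i<m. p i * a (Suc i) + q i * a i = e i"
  shows "\<exists>a'. (\<forall>i\<le>m. a' i = a i) \<and> (\<forall>i<k. p i * a' (Suc i) + q i * a' i = e i)"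
  using assms
proof (induction k rule: dec_induct)
  case base
  then show ?case by blast
next
  case (step k)
  then obtain a' where a': "\<forall>i\<le>m. a' i = a i" "\<forall>i<k. p i * a' (Suc i) + q i * a' i = e i"
    by auto
  have "p k \<noteq> 0"
    using step by simp
  then show ?case
    using a' step.hyps
    by (intro exI[of _ "a'(Suc k := (e k - q k * a' k) / p k)"]) (auto simp: less_Suc_eq)
qed

text \<open>Start from the prescribed entry \<open>a m\<close>: solve downwards dividing by
  \<open>q\<close>, upwards dividing by \<open>p\<close>.\<close>

lemma bidiagonal_solvable:
  fixes p q e :: "nat \<Rightarrow> real"
  assumes "m \<le> k" "\<And>i. i < m \<Longrightarrow> q i \<noteq> 0" "\<And>i. m \<le> i \<Longrightarrow> i < k \<Longrightarrow> p i \<noteq> 0"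
  shows "\<exists>a. a m = v \<and> (\<forall>i<k. p i * a (Suc i) + q i * a i = e i)"
proof -
  have "\<exists>a. a m = v \<and> (\<forall>i<m. p i * a (Suc i) + q i * a i = e i)"
    using assms(2)
  proof (induction m arbitrary: v)
    case 0
    then show ?case by auto
  next
    case (Suc m)
    \<comment> \<open>This value makes row \<open>m\<close> hold once entry \<open>Suc m\<close> is
      set to \<open>v\<close>.\<close>
    then obtain a where "a m = (e m - p m * v) / q m" "\<forall>i<m. p i * a (Suc i) + q i * a i = e i"
      by (metis less_SucI)
    moreover have "q m \<noteq> 0"
      using Suc.prems by simp
    ultimately show ?case
      by (intro exI[of _ "a(Suc m := v)"]) (auto simp: less_Suc_eq)
  qed
  then show ?thesis
    using bidiagonal_extend[of m k p _ q e] assms by (metis order_refl)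
qed

text \<open>The zero at \<open>m\<close> propagates down to \<open>j\<close> through
  \<open>q\<close> and up to \<open>k\<close> through \<open>p\<close>.\<close>

lemma bidiagonal_unique:
  fixes p q :: "nat \<Rightarrow> real"
  assumes "j \<le> m" "\<And>i. j \<le> i \<Longrightarrow> i < m \<Longrightarrow> q i \<noteq> 0" "\<And>i. m \<le> i \<Longrightarrow> i < k \<Longrightarrow> p i \<noteq> 0"
    and eq: "\<And>i. j \<le> i \<Longrightarrow> i < k \<Longrightarrow> p i * a (Suc i) + q i * a i = 0" and "a m = 0"
    and "m \<le> k" "j \<le> i" "i \<le> k"
  shows "a i = 0"
proof (cases "i \<le> m")
  case True
  then show ?thesis
    using \<open>j \<le> i\<close>
  proof (induction rule: inc_induct)
    case (step i)
    then show ?case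
      using eq[of i] assms(2)[of i] \<open>m \<le> k\<close> by simp
  qed (use \<open>a m = 0\<close> in simp)
next
  case False
  then have "m \<le> i" by simp
  then show ?thesis
    using \<open>i \<le> k\<close>
  proof (induction rule: dec_induct)
    case (step i)
    then show ?case
      using eq[of i] assms(3)[of i] \<open>j \<le> m\<close> by simp
  qed (use \<open>a m = 0\<close> in simp)
qed

text \<open>The zeros \<open>q r\<close> and \<open>p s\<close> isolate the rows from r to s, which
  then form s - r + 1 equations in only s - r unknowns and so satisfy a linear relation.\<close>

lemma bidiagonal_left_kernel:
  fixes p q :: "nat \<Rightarrow> real"
  assumes "r \<le> s" "q r = 0" "p s = 0"
    and "\<And>i. r < i \<Longrightarrow> i \<le> s \<Longrightarrow> q i \<noteq> 0" "\<And>i. r \<le> i \<Longrightarrow> i < s \<Longrightarrow> p i \<noteq> 0"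
  obtains b where "\<And>i. r \<le> i \<Longrightarrow> i \<le> s \<Longrightarrow> b i \<noteq> 0" "\<And>i. s < i \<Longrightarrow> b i = 0"
    and "\<And>a k. s < k \<Longrightarrow> (\<Sum>i<k. b i * (p i * a (Suc i) + q i * a i)) = 0"
proof
  \<comment> \<open>The ratios make the two contributions to each entry of \<open>a\<close>
    cancel.\<close>
  define b where "b i = (if r \<le> i \<and> i \<le> s then \<Prod>j=r..<i. - p j / q (Suc j) else 0)" for i
  show "b i \<noteq> 0" if "r \<le> i" "i \<le> s" for i
    using that assms(4,5) by (auto simp: b_def)
  show "b i = 0" if "s < i" for i
    using that by (simp add: b_def)
  have step: "b i * p i + b (Suc i) * q (Suc i) = 0" for i
  proof -
    consider "Suc i < r" | "Suc i = r" | "r \<le> i" "i < s" | "i = s" | "s < i" by linarith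
    then show ?thesis
    proof cases
      case 3
      then show ?thesis
        using assms(4)[of "Suc i"] by (simp add: b_def)
    qed (use assms in \<open>auto simp: b_def\<close>)
  qed
  \<comment> \<open>The sum telescopes to a boundary term, which is 0 once k > s.\<close>
  have partial: "(\<Sum>i<k. b i * (p i * a (Suc i) + q i * a i)) = - (b k * q k * a k)" for a k
  proof (induction k)
    case 0
    show ?case
      using assms(2) by (auto simp: b_def)
  next
    case (Suc k)
    have "(\<Sum>i<Suc k. b i * (p i * a (Suc i) + q i * a i)) = b k * p k * a (Suc k)"
      unfolding sum.lessThan_Suc Suc by (simp add: algebra_simps)
    also have "b k * p k = - (b (Suc k) * q (Suc k))"
      using step[of k] by linarith
    finally show ?case by simp
  qed
  show "(\<Sum>i<k. b i * (p i * a (Suc i) + q i * a i)) = 0" if "s < k" for a k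
    using that by (simp add: partial) (simp add: b_def)
qed

text \<open>Rows before s are solved from \<open>a r\<close>, rows after s from
  \<open>a (Suc s)\<close>; row s then follows from the orthogonality of \<open>e\<close> to
  \<open>b\<close>.\<close>

lemma bidiagonal_special_solvable:
  fixes p q e :: "nat \<Rightarrow> real"
  assumes "r \<le> s" "s < k" "p s = 0"
    and q: "\<And>i. i < r \<Longrightarrow> q i \<noteq> 0" and p: "\<And>i. r \<le> i \<Longrightarrow> i < k \<Longrightarrow> i \<noteq> s \<Longrightarrow> p i \<noteq> 0"
    and b: "b s \<noteq> 0" "\<And>i. s < i \<Longrightarrow> b i = 0"
      "\<And>a. (\<Sum>i<k. b i * (p i * a (Suc i) + q i * a i)) = 0" "(\<Sum>i<k. b i * e i) = 0"
  shows "\<exists>a. a r = v \<and> a (Suc s) = w \<and> (\<forall>i<k. p i * a (Suc i) + q i * a i = e i)"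
proof -
  have "\<exists>a. a r = v \<and> (\<forall>i<s. p i * a (Suc i) + q i * a i = e i)"
    using assms by (intro bidiagonal_solvable) auto
  then obtain a0 where a0: "a0 r = v" "\<forall>i<s. p i * a0 (Suc i) + q i * a0 i = e i"
    by blast
  \<comment> \<open>Rows below s do not involve entry \<open>Suc s\<close>, and in row s its factor
    \<open>p s\<close> is 0.\<close>
  define a where "a = a0(Suc s := w)"
  have a: "a r = v" "a (Suc s) = w" "\<forall>i<s. p i * a (Suc i) + q i * a i = e i"
    using a0 \<open>r \<le> s\<close> by (auto simp: a_def)
  \<comment> \<open>Pairing the residual with \<open>b\<close> leaves only row s: earlier residuals
    are 0 and \<open>b\<close> vanishes later.\<close>
  have "0 = (\<Sum>i<k. b i * (e i - (p i * a (Suc i) + q i * a i)))"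
    using b(3)[of a] b(4) by (simp add: right_diff_distrib sum_subtractf)
  also have "\<dots> = (\<Sum>i<k. if i = s then b i * (e i - (p i * a (Suc i) + q i * a i)) else 0)"
    using a(3) b(2) by (intro sum.cong) (auto, metis linorder_neqE_nat)
  also have "\<dots> = b s * (e s - (p s * a (Suc s) + q s * a s))"
    using \<open>s < k\<close> by simp
  finally have "\<forall>i<Suc s. p i * a (Suc i) + q i * a i = e i"
    using a(3) b(1) by (auto simp: less_Suc_eq)
  with bidiagonal_extend[of "Suc s" k p a q e] assms
  obtain a' where "\<forall>i\<le>Suc s. a' i = a i" "\<forall>i<k. p i * a' (Suc i) + q i * a' i = e i"
    by auto
  with a \<open>r \<le> s\<close> show ?thesis
    by (intro exI[of _ a']) auto
qed

subsection \<open>The cohomology groups\<close>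

text \<open>With all zeros of the \<open>p\<close> diagonal before r and none of the
  \<open>q\<close> diagonal there, T is onto and its kernel is parametrised by
  \<open>C r\<close>.\<close>

lemma H1_one_dimensional:
  assumes k: "m - l - n = real k" and r: "r \<le> k"
    and q: "\<And>i. i < r \<Longrightarrow> real k - real i - 1 + 2 * n \<noteq> 0"
    and p: "\<And>i. r \<le> i \<Longrightarrow> i < k \<Longrightarrow> real i + 2 * l \<noteq> 0"
  shows "H1_isomorphic l n m (UNIV :: real set)"
proof (rule H1_isomorphicI[OF k, of "\<lambda>(C, E). C r"])
  show "linear (\<lambda>(C :: nat \<Rightarrow> real, E :: nat \<Rightarrow> real). C r)"
    by (rule linearI) (auto simp: scaleR_fun_apply)
  let ?p = "\<lambda>i. (real i + 1) * (real i + 2 * l)"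
  let ?q = "\<lambda>i. (real k - real i) * (real k - real i - 1 + 2 * n)"
  have q': "?q i \<noteq> 0" if "i < r" for i
    using q[OF that] that r by simp
  have p': "?p i \<noteq> 0" if "r \<le> i" "i < k" for i
    using p[OF that] by simp
  have solve: "\<exists>a. a r = v \<and> (\<forall>i<k. bidiagonal l n k a i = e i)" for v and e :: "nat \<Rightarrow> real"
    unfolding bidiagonal_def using bidiagonal_solvable[OF r, of ?q ?p v e] q' p' by blast
  show "\<exists>C E. (\<forall>i<k. bidiagonal l n k C i = 0) \<and> (case (C, E :: nat \<Rightarrow> real) of (C, E) \<Rightarrow> C r) = w" for w
    using solve[of w "\<lambda>_. 0"] by auto
  fix C E :: "nat \<Rightarrow> real"
  assume C: "\<And>i. i < k \<Longrightarrow> bidiagonal l n k C i = 0"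
  have "C i = 0" if "C r = 0" "i \<le> k" for i
    using bidiagonal_unique[of 0 r ?q k ?p C i] r q' p' C that by (simp add: bidiagonal_def)
  moreover have "\<exists>a. \<forall>i<k. E i = bidiagonal l n k a i"
    using solve[of 0 E] by metis
  ultimately show "(case (C, E) of (C, E) \<Rightarrow> C r) = 0 \<longleftrightarrow>
      (\<forall>i\<le>k. C i = 0) \<and> (\<exists>a. \<forall>i<k. E i = bidiagonal l n k a i)"
    using r by auto
qed

text \<open>Here T has rank k - 1: \<open>C r\<close> and \<open>C (Suc s)\<close> are coordinates
  on its kernel, and pairing with \<open>b\<close> is the coordinate on its cokernel.\<close>

lemma H1_three_dimensional:
  assumes k: "m - l - n = real k" and l: "l = - real s / 2" and n: "n = - real t / 2"
    and st: "s < k" "t < k" "k < s + t + 2"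
  shows "H1_isomorphic l n m (UNIV :: (real ^ 3) set)"
proof -
  \<comment> \<open>The unique zero of the \<open>q\<close> diagonal; k < s + t + 2 says exactly r
    \<le> s.\<close>
  define r where "r = k - Suc t"
  have r: "r \<le> s" "r < k"
    using st by (auto simp: r_def)
  define p where "p i = (real i + 1) * (real i + 2 * l)" for i
  define q where "q i = (real k - real i) * (real k - real i - 1 + 2 * n)" for i
  have bd: "bidiagonal l n k a i = p i * a (Suc i) + q i * a i" for a i
    by (simp add: bidiagonal_def p_def q_def)
  have p: "p i = 0 \<longleftrightarrow> i = s" for i
    by (auto simp: p_def l)
  have q: "q i = 0 \<longleftrightarrow> i = r" if "i < k" for i
    using that st(2) by (auto simp: q_def n r_def)
  obtain b where b: "\<And>i. r \<le> i \<Longrightarrow> i \<le> s \<Longrightarrow> b i \<noteq> 0" "\<And>i. s < i \<Longrightarrow> b i = 0"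
      "\<And>a k. s < k \<Longrightarrow> (\<Sum>i<k. b i * (p i * a (Suc i) + q i * a i)) = 0"
    using r st by (rule_tac bidiagonal_left_kernel[of r s q p]) (auto simp: p q)
  have solve: "\<exists>a. a r = v \<and> a (Suc s) = w \<and> (\<forall>i<k. bidiagonal l n k a i = e i)"
    if "(\<Sum>i<k. b i * e i) = 0" for v w e
    unfolding bd using r st that b by (intro bidiagonal_special_solvable[of r s k p q b]) (auto simp: p q)
  define f :: "(nat \<Rightarrow> real) \<times> (nat \<Rightarrow> real) \<Rightarrow> real ^ 3"
    where "f = (\<lambda>(C, E). vector [C r, C (Suc s), \<Sum>i<k. b i * E i])"
  show ?thesis
  proof (rule H1_isomorphicI[OF k, of f])
    show "linear f"
      by (rule linearI) (auto simp: f_def vec_eq_iff forall_3 scaleR_fun_apply sum.distrib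
          sum_distrib_left algebra_simps)
    show "\<exists>C E. (\<forall>i<k. bidiagonal l n k C i = 0) \<and> f (C, E) = w" for w
    proof -
      obtain C where C: "C r = w $ 1" "C (Suc s) = w $ 2" "\<forall>i<k. bidiagonal l n k C i = 0"
        using solve[of "\<lambda>_. 0" "w $ 1" "w $ 2"] by auto
      \<comment> \<open>Since \<open>b r\<close> is nonzero, an \<open>E\<close> supported at r
        attains any third coordinate.\<close>
      have "(\<Sum>i<k. b i * (if i = r then w $ 3 / b r else 0)) = w $ 3"
        using r b(1)[of r] by (simp add: if_distrib cong: if_cong)
      with C show ?thesis
        by (intro exI[of _ C] exI[of _ "\<lambda>i. if i = r then w $ 3 / b r else 0"])
          (simp add: f_def vec_eq_iff forall_3)
    qed
    fix C E :: "nat \<Rightarrow> real"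
    assume C: "\<And>i. i < k \<Longrightarrow> bidiagonal l n k C i = 0"
    have "C i = 0" if "C r = 0" "C (Suc s) = 0" "i \<le> k" for i
    \<comment> \<open>As \<open>p s\<close> = 0, entries up to s are governed by \<open>C r\<close>
      and later ones by \<open>C (Suc s)\<close>.\<close>
    proof (cases "i \<le> s")
      case True
      then show ?thesis
        using C r st p q that by (intro bidiagonal_unique[of 0 r q s p C i]) (auto simp: bd)
    next
      case False
      then show ?thesis
        using C r st p q that by (intro bidiagonal_unique[of "Suc s" "Suc s" q k p C i]) (auto simp: bd)
    qed
    moreover have "\<exists>a. \<forall>i<k. E i = bidiagonal l n k a i" if "(\<Sum>i<k. b i * E i) = 0"
      using solve[OF that] by metis
    moreover have "(\<Sum>i<k. b i * E i) = 0" if "\<forall>i<k. E i = bidiagonal l n k a i" for a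
      using b(3)[OF st(1), of a] that by (simp add: bd)
    ultimately show "f (C, E) = 0 \<longleftrightarrow> (\<forall>i\<le>k. C i = 0) \<and> (\<exists>a. \<forall>i<k. E i = bidiagonal l n k a i)"
      using r st by (auto simp: f_def vec_eq_iff forall_3)
  qed
qed

text \<open>The pivot is the zero of the factor of \<open>a i\<close> if one lies below k, and k
  otherwise.\<close>

lemma H1_generic:
  assumes k: "m - l - n = real k"
    and generic: "\<nexists>s t. l = - real s / 2 \<and> n = - real t / 2 \<and> s < k \<and> t < k \<and> k < s + t + 2"
  shows "H1_isomorphic l n m (UNIV :: real set)"
proof (cases "\<exists>i<k. real k - real i - 1 + 2 * n = 0")
  case True
  then obtain r where r: "r < k" "real k - real r - 1 + 2 * n = 0"
    by blast
  have "real i + 2 * l \<noteq> 0" if "r \<le> i" "i < k" for i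
  proof
    assume "real i + 2 * l = 0"
    \<comment> \<open>A zero of the other diagonal at i \<ge> r would give the excluded pair s = i,
      t = k - 1 - r.\<close>
    then have "l = - real i / 2" "n = - real (k - Suc r) / 2" "k - Suc r < k" "k < i + (k - Suc r) + 2"
      using r that by auto
    with generic that show False by blast
  qed
  with r show ?thesis
    by (intro H1_one_dimensional[OF k, of r]) auto
next
  case False
  then show ?thesis
    by (intro H1_one_dimensional[OF k, of k]) auto
qed

theorem theorem3p1:
  fixes lam nu mu :: real
  shows "(mu = lam + nu \<longrightarrow> H1_isomorphic lam nu mu (UNIV :: real set)) \<and>
    (\<forall>k::int. k > 0 \<and> mu - lam - nu = of_int k \<longrightarrow>
      (if \<exists>s t :: int. lam = - of_int s / 2 \<and> nu = - of_int t / 2 \<and>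
            0 \<le> s \<and> s \<le> k - 1 \<and> 0 \<le> t \<and> t \<le> k - 1 \<and> t > k - s - 2
       then H1_isomorphic lam nu mu (UNIV :: (real ^ 3) set)
       else H1_isomorphic lam nu mu (UNIV :: real set))) \<and>
    (mu - lam - nu \<notin> \<nat> \<longrightarrow> H1_isomorphic lam nu mu ({0} :: real set))"
proof (intro conjI impI allI)
  show "H1_isomorphic lam nu mu (UNIV :: real set)" if "mu = lam + nu"
    \<comment> \<open>For k = 0 no natural number s < k exists, so the exceptional case is
      empty.\<close>
    using that by (intro H1_generic[of mu lam nu 0]) auto
  show "H1_isomorphic lam nu mu ({0} :: real set)" if "mu - lam - nu \<notin> \<nat>"
    using that by (rule H1_trivial)
  fix k :: int
  assume "k > 0 \<and> mu - lam - nu = of_int k"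
  then obtain j where j: "k = int j" "mu - lam - nu = real j"
    by (metis of_int_of_nat_eq order_less_imp_le zero_le_imp_eq_int)
  let ?special = "\<exists>s t. lam = - real s / 2 \<and> nu = - real t / 2 \<and> s < j \<and> t < j \<and> j < s + t + 2"
  have "(\<exists>s t :: int. lam = - of_int s / 2 \<and> nu = - of_int t / 2 \<and>
            0 \<le> s \<and> s \<le> k - 1 \<and> 0 \<le> t \<and> t \<le> k - 1 \<and> t > k - s - 2) \<longleftrightarrow> ?special"
    (is "?int \<longleftrightarrow> _")
  proof
    assume ?int
    then obtain s t :: int where "lam = - of_int s / 2" "nu = - of_int t / 2"
      "0 \<le> s" "s \<le> k - 1" "0 \<le> t" "t \<le> k - 1" "t > k - s - 2"
      by blast
    with j show ?special
      by (intro exI[of _ "nat s"] exI[of _ "nat t"]) auto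
  next
    assume ?special
    then obtain s t where "lam = - real s / 2" "nu = - real t / 2" "s < j" "t < j" "j < s + t + 2"
      by blast
    with j show ?int
      by (intro exI[of _ "int s"] exI[of _ "int t"]) auto
  qed
  moreover have "H1_isomorphic lam nu mu (UNIV :: (real ^ 3) set)" if ?special
    using that H1_three_dimensional[OF j(2)] by blast
  moreover have "H1_isomorphic lam nu mu (UNIV :: real set)" if "\<not> ?special"
    using that H1_generic[OF j(2)] by blast
  ultimately show "if \<exists>s t :: int. lam = - of_int s / 2 \<and> nu = - of_int t / 2 \<and>
            0 \<le> s \<and> s \<le> k - 1 \<and> 0 \<le> t \<and> t \<le> k - 1 \<and> t > k - s - 2
       then H1_isomorphic lam nu mu (UNIV :: (real ^ 3) set)
       else H1_isomorphic lam nu mu (UNIV :: real set)"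
    by simp
qed

end
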